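(* There is an equivalence of categories $$S_\times\mathrm{Set}\simeq\mathrm{SSet}$$ between the category of templicial objects in $(\mathrm{Set},\times,\{*\})$ and the category of simplicial sets.
   Context: For a set $S$, $\mathrm{Quiv}_S$ is the category of families $Q=(Q(a,b))_{a,b\in S}$ of sets, with families of maps as morphisms. It is monoidal with $(Q\otimes_S P)(a,b)=\coprod_{c\in S}Q(a,c)\times P(c,b)$ and unit $I_S$, where $I_S(a,b)$ is a singleton if $a=b$ and empty otherwise. For a map of sets $f:S\to T$, the functor $f^*:\mathrm{Quiv}_T\to\mathrm{Quiv}_S$, $f^*(Q)(a,b)=Q(f(a),f(b))$, is lax monoidal; its left adjoint $f_!$, given by $f_!(Q)(x,y)=\coprod_{f(a)=x,f(b)=y}Q(a,b)$, is therefore colax monoidal. $\mathbf{\Delta}_f$ is the category with objects $[n]=\{0,\dots,n\}$, $n\ge0$, and order-preserving maps $f:[m]\to[n]$ with $f(0)=0$, $f(m)=n$. It is monoidal with $[m]+[n]=[m+n]$, where for $f:[m]\to[m']$, $g:[n]\to[n']$ one has $(f+g)(i)=f(i)$ for $i\le m$ and $(f+g)(i)=m'+g(i-m)$ for $i\ge m$; the unit is $[0]$. A templicial object in $\mathrm{Set}$ is a pair $(X,S)$ with $S$ a set and $X:\mathbf{\Delta}_f^{op}\to\mathrm{Quiv}_S$ a colax monoidal functor which is strongly unital (the counit $X_0\to I_S$ is an isomorphism). A morphism $(X,S)\to(Y,T)$ is a pair $(\alpha,f)$ with $f:S\to T$ a map and $\alpha:f_!X\to Y$ a monoidal natural transformation.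 The composite of $(\alpha,f)$ and $(\beta,g)$ is $(gf)_!X\simeq g_!f_!X\xrightarrow{g_!\alpha}g_!Y\xrightarrow{\beta}Z$ over $gf$. These form the category $S_\times\mathrm{Set}$. *)

theory Defs
  imports Main "HOL-Library.FuncSet"
begin

section \<open>Categories, functors, equivalences\<close>

text \<open>
  Morphisms do not carry their domain and codomain, so composition and the action of a functor
  on morphisms take the objects as arguments. \<open>Comp C a b c g f\<close> is the composite
  of \<open>f : a \<rightarrow> b\<close> and \<open>g : b \<rightarrow> c\<close>.
\<close>

record ('o, 'm) cat =
  Ob :: "'o set"
  Hom :: "'o \<Rightarrow> 'o \<Rightarrow> 'm set"
  Id :: "'o \<Rightarrow> 'm"
  Comp :: "'o \<Rightarrow> 'o \<Rightarrow> 'o \<Rightarrow> 'm \<Rightarrow> 'm \<Rightarrow> 'm"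

locale category =
  fixes C :: "('o, 'm) cat"
  assumes Id_in_Hom: "a \<in> Ob C \<Longrightarrow> Id C a \<in> Hom C a a"
    and Comp_in_Hom: "\<lbrakk>a \<in> Ob C; b \<in> Ob C; c \<in> Ob C; f \<in> Hom C a b; g \<in> Hom C b c\<rbrakk>
      \<Longrightarrow> Comp C a b c g f \<in> Hom C a c"
    and Comp_Id_right: "\<lbrakk>a \<in> Ob C; b \<in> Ob C; f \<in> Hom C a b\<rbrakk> \<Longrightarrow> Comp C a a b f (Id C a) = f"
    and Comp_Id_left: "\<lbrakk>a \<in> Ob C; b \<in> Ob C; f \<in> Hom C a b\<rbrakk> \<Longrightarrow> Comp C a b b (Id C b) f = f"
    and Comp_assoc: "\<lbrakk>a \<in> Ob C; b \<in> Ob C; c \<in> Ob C; d \<in> Ob C;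
        f \<in> Hom C a b; g \<in> Hom C b c; h \<in> Hom C c d\<rbrakk>
      \<Longrightarrow> Comp C a b d (Comp C b c d h g) f = Comp C a c d h (Comp C a b c g f)"

definition op_cat :: "('o, 'm) cat \<Rightarrow> ('o, 'm) cat" where
  "op_cat C = \<lparr>Ob = Ob C, Hom = (\<lambda>a b. Hom C b a), Id = Id C,
     Comp = (\<lambda>a b c g f. Comp C c b a f g)\<rparr>"

text \<open>
  The values of a functor on arguments that are not objects or morphisms of its domain are
  arbitrary. Functors that differ only there are different records, but they are isomorphic
  objects in each of the categories below.
\<close>

record ('o, 'm, 'p, 'n) fctr =
  obj_map :: "'o \<Rightarrow> 'p"
  arr_map :: "'o \<Rightarrow> 'o \<Rightarrow> 'm \<Rightarrow> 'n"

locale cat_functor = A: category C + B: category D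
  for C :: "('o, 'm) cat" and D :: "('p, 'n) cat" +
  fixes F :: "('o, 'm, 'p, 'n, 'z) fctr_scheme"
  assumes obj_map_in_Ob: "a \<in> Ob C \<Longrightarrow> obj_map F a \<in> Ob D"
    and arr_map_in_Hom: "\<lbrakk>a \<in> Ob C; b \<in> Ob C; f \<in> Hom C a b\<rbrakk>
      \<Longrightarrow> arr_map F a b f \<in> Hom D (obj_map F a) (obj_map F b)"
    and arr_map_Id: "a \<in> Ob C \<Longrightarrow> arr_map F a a (Id C a) = Id D (obj_map F a)"
    and arr_map_Comp: "\<lbrakk>a \<in> Ob C; b \<in> Ob C; c \<in> Ob C; f \<in> Hom C a b; g \<in> Hom C b c\<rbrakk>
      \<Longrightarrow> arr_map F a c (Comp C a b c g f)
          = Comp D (obj_map F a) (obj_map F b) (obj_map F c) (arr_map F b c g) (arr_map F a b f)"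

definition id_functor :: "('o, 'm, 'o, 'm) fctr" where
  "id_functor = \<lparr>obj_map = (\<lambda>a. a), arr_map = (\<lambda>a b f. f)\<rparr>"

definition comp_functor ::
  "('p, 'n, 'q, 'k) fctr \<Rightarrow> ('o, 'm, 'p, 'n) fctr \<Rightarrow> ('o, 'm, 'q, 'k) fctr" where
  "comp_functor G F = \<lparr>obj_map = (\<lambda>a. obj_map G (obj_map F a)),
     arr_map = (\<lambda>a b f. arr_map G (obj_map F a) (obj_map F b) (arr_map F a b f))\<rparr>"

locale natural_transformation = F: cat_functor C D F + G: cat_functor C D G
  for C :: "('o, 'm) cat" and D :: "('p, 'n) cat"
    and F G :: "('o, 'm, 'p, 'n) fctr" +
  fixes \<tau> :: "'o \<Rightarrow> 'n"
  assumes component_in_Hom: "a \<in> Ob C \<Longrightarrow> \<tau> a \<in> Hom D (obj_map F a) (obj_map G a)"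
    and naturality: "\<lbrakk>a \<in> Ob C; b \<in> Ob C; f \<in> Hom C a b\<rbrakk>
      \<Longrightarrow> Comp D (obj_map F a) (obj_map F b) (obj_map G b) (\<tau> b) (arr_map F a b f)
        = Comp D (obj_map F a) (obj_map G a) (obj_map G b) (arr_map G a b f) (\<tau> a)"

definition iso_in :: "('o, 'm) cat \<Rightarrow> 'o \<Rightarrow> 'o \<Rightarrow> 'm \<Rightarrow> bool" where
  "iso_in C a b f \<longleftrightarrow> f \<in> Hom C a b \<and>
     (\<exists>g \<in> Hom C b a. Comp C a b a g f = Id C a \<and> Comp C b a b f g = Id C b)"

definition natural_isomorphism ::
  "('o, 'm) cat \<Rightarrow> ('p, 'n) cat \<Rightarrow> ('o, 'm, 'p, 'n) fctr \<Rightarrow> ('o, 'm, 'p, 'n) fctr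
    \<Rightarrow> ('o \<Rightarrow> 'n) \<Rightarrow> bool" where
  "natural_isomorphism C D F G \<tau> \<longleftrightarrow> natural_transformation C D F G \<tau> \<and>
     (\<forall>a \<in> Ob C. iso_in D (obj_map F a) (obj_map G a) (\<tau> a))"

definition equivalent_categories :: "('o, 'm) cat \<Rightarrow> ('p, 'n) cat \<Rightarrow> bool" where
  "equivalent_categories C D \<longleftrightarrow>
     (\<exists>F G \<eta> \<epsilon>. cat_functor C D F \<and> cat_functor D C G \<and>
        natural_isomorphism C C id_functor (comp_functor G F) \<eta> \<and>
        natural_isomorphism D D (comp_functor F G) id_functor \<epsilon>)"

definition functor_category ::
  "('o, 'm) cat \<Rightarrow> ('p, 'n) cat \<Rightarrow> (('o, 'm, 'p, 'n) fctr, 'o \<Rightarrow> 'n) cat" where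
  "functor_category C D =
    \<lparr>Ob = {F. cat_functor C D F},
     Hom = (\<lambda>F G. {\<tau> \<in> extensional (Ob C). natural_transformation C D F G \<tau>}),
     Id = (\<lambda>F. \<lambda>a\<in>Ob C. Id D (obj_map F a)),
     Comp = (\<lambda>F G H \<tau> \<sigma>. \<lambda>a\<in>Ob C.
       Comp D (obj_map F a) (obj_map G a) (obj_map H a) (\<tau> a) (\<sigma> a))\<rparr>"


section \<open>Simplicial sets\<close>

text \<open>
  The sets are the subsets of a type \<open>'u\<close>, which plays the role of a universe. If \<open>'u\<close> is
  infinite, it is closed, up to bijection, under binary products and under coproducts indexed
  by subsets of \<open>'u\<close>, which are the operations that the tensor product of quivers and
  the functors \<open>f\<^sub>!\<close> need.
\<close>

definition Set_cat :: "('u set, 'u \<Rightarrow> 'u) cat" where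
  "Set_cat = \<lparr>Ob = UNIV, Hom = (\<lambda>A B. A \<rightarrow>\<^sub>E B), Id = (\<lambda>A. \<lambda>x\<in>A. x),
     Comp = (\<lambda>A B C g f. compose A g f)\<rparr>"

text \<open>The object \<open>n\<close> of the following two categories is the ordered set \<open>[n] = {0..n}\<close>.\<close>

definition Delta :: "(nat, nat \<Rightarrow> nat) cat" where
  "Delta = \<lparr>Ob = UNIV, Hom = (\<lambda>m n. {h \<in> {0..m} \<rightarrow>\<^sub>E {0..n}. mono_on {0..m} h}),
     Id = (\<lambda>n. \<lambda>i\<in>{0..n}. i), Comp = (\<lambda>l m n g h. compose {0..l} g h)\<rparr>"

definition Delta_f :: "(nat, nat \<Rightarrow> nat) cat" where
  "Delta_f = \<lparr>Ob = UNIV, Hom = (\<lambda>m n. {h \<in> Hom Delta m n. h 0 = 0 \<and> h m = n}),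
     Id = Id Delta, Comp = Comp Delta\<rparr>"

text \<open>The monoidal product of \<open>f : [m] \<rightarrow> [m']\<close> and \<open>g : [n] \<rightarrow> [n']\<close> in \<open>Delta_f\<close>.\<close>

definition Delta_f_add ::
  "nat \<Rightarrow> nat \<Rightarrow> nat \<Rightarrow> (nat \<Rightarrow> nat) \<Rightarrow> (nat \<Rightarrow> nat) \<Rightarrow> nat \<Rightarrow> nat" where
  "Delta_f_add m m' n f g = (\<lambda>i\<in>{0..m + n}. if i \<le> m then f i else m' + g (i - m))"

type_synonym 'u sset = "(nat, nat \<Rightarrow> nat, 'u set, 'u \<Rightarrow> 'u) fctr"

definition SSet :: "('u sset, nat \<Rightarrow> 'u \<Rightarrow> 'u) cat" where
  "SSet = functor_category (op_cat Delta) Set_cat"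


section \<open>Quivers\<close>

text \<open>
  A quiver on \<open>S\<close> is a family indexed by \<open>S \<times> S\<close>, extended by the empty set to the whole type.
  Tensor products and coproducts of quivers are formed with product types, so
  the element type changes; maps of quivers may go between different element types.
\<close>

type_synonym ('s, 'q) quiver = "'s \<Rightarrow> 's \<Rightarrow> 'q set"
type_synonym ('s, 'q, 'p) quiver_map = "'s \<Rightarrow> 's \<Rightarrow> 'q \<Rightarrow> 'p"

definition quiver_on :: "'s set \<Rightarrow> ('s, 'q) quiver \<Rightarrow> bool" where
  "quiver_on S Q \<longleftrightarrow> (\<forall>a b. \<not> (a \<in> S \<and> b \<in> S) \<longrightarrow> Q a b = {})"

definition quiv_hom :: "('s, 'q) quiver \<Rightarrow> ('s, 'p) quiver \<Rightarrow> ('s, 'q, 'p) quiver_map set" where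
  "quiv_hom Q P = {\<phi>. \<forall>a b. \<phi> a b \<in> Q a b \<rightarrow>\<^sub>E P a b}"

definition quiv_id :: "('s, 'q) quiver \<Rightarrow> ('s, 'q, 'q) quiver_map" where
  "quiv_id Q = (\<lambda>a b. \<lambda>q\<in>Q a b. q)"

definition quiv_comp ::
  "('s, 'q) quiver \<Rightarrow> ('s, 'p, 'r) quiver_map \<Rightarrow> ('s, 'q, 'p) quiver_map
    \<Rightarrow> ('s, 'q, 'r) quiver_map" where
  "quiv_comp Q \<psi> \<phi> = (\<lambda>a b. compose (Q a b) (\<psi> a b) (\<phi> a b))"

definition Quiv :: "'s set \<Rightarrow> (('s, 'q) quiver, ('s, 'q, 'q) quiver_map) cat" where
  "Quiv S = \<lparr>Ob = {Q. quiver_on S Q}, Hom = quiv_hom, Id = quiv_id,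
     Comp = (\<lambda>Q P R \<psi> \<phi>. quiv_comp Q \<psi> \<phi>)\<rparr>"

definition quiv_iso :: "('s, 'q) quiver \<Rightarrow> ('s, 'p) quiver \<Rightarrow> ('s, 'q, 'p) quiver_map \<Rightarrow> bool" where
  "quiv_iso Q P \<phi> \<longleftrightarrow> \<phi> \<in> quiv_hom Q P \<and>
     (\<exists>\<psi> \<in> quiv_hom P Q. quiv_comp Q \<psi> \<phi> = quiv_id Q \<and> quiv_comp P \<phi> \<psi> = quiv_id P)"

subsection \<open>Monoidal structure\<close>

definition tensor ::
  "'s set \<Rightarrow> ('s, 'q) quiver \<Rightarrow> ('s, 'p) quiver \<Rightarrow> ('s, 's \<times> 'q \<times> 'p) quiver" where
  "tensor S Q P = (\<lambda>a b. SIGMA c:S. Q a c \<times> P c b)"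

definition tensor_map ::
  "'s set \<Rightarrow> ('s, 'q) quiver \<Rightarrow> ('s, 'p) quiver
    \<Rightarrow> ('s, 'q, 'q') quiver_map \<Rightarrow> ('s, 'p, 'p') quiver_map
    \<Rightarrow> ('s, 's \<times> 'q \<times> 'p, 's \<times> 'q' \<times> 'p') quiver_map" where
  "tensor_map S Q P \<phi> \<psi> = (\<lambda>a b. \<lambda>(c, q, p)\<in>tensor S Q P a b. (c, \<phi> a c q, \<psi> c b p))"

definition unit_quiver :: "'s set \<Rightarrow> ('s, unit) quiver" where
  "unit_quiver S = (\<lambda>a b. if a \<in> S \<and> a = b then {()} else {})"

definition associator ::
  "'s set \<Rightarrow> ('s, 'q) quiver \<Rightarrow> ('s, 'p) quiver \<Rightarrow> ('s, 'r) quiver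
    \<Rightarrow> ('s, 's \<times> ('s \<times> 'q \<times> 'p) \<times> 'r, 's \<times> 'q \<times> ('s \<times> 'p \<times> 'r)) quiver_map" where
  "associator S Q P R =
    (\<lambda>a b. \<lambda>(d, (c, q, p), r)\<in>tensor S (tensor S Q P) R a b. (c, q, (d, p, r)))"

definition left_unitor ::
  "'s set \<Rightarrow> ('s, 'q) quiver \<Rightarrow> ('s, 's \<times> unit \<times> 'q, 'q) quiver_map" where
  "left_unitor S Q = (\<lambda>a b. \<lambda>(c, u, q)\<in>tensor S (unit_quiver S) Q a b. q)"

definition right_unitor ::
  "'s set \<Rightarrow> ('s, 'q) quiver \<Rightarrow> ('s, 's \<times> 'q \<times> unit, 'q) quiver_map" where
  "right_unitor S Q = (\<lambda>a b. \<lambda>(c, q, u)\<in>tensor S Q (unit_quiver S) a b. q)"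

subsection \<open>Change of base\<close>

text \<open>
  For \<open>f : S \<rightarrow> T\<close>: the functor \<open>f\<^sup>*\<close> (\<open>pull\<close>) with its lax monoidal structure, its left adjoint
  \<open>f\<^sub>!\<close> (\<open>push\<close>) with the unit and counit of the adjunction, and the colax monoidal structure
  on \<open>f\<^sub>!\<close> that is the mate of the lax structure on \<open>f\<^sup>*\<close>.
\<close>

definition pull :: "('s \<Rightarrow> 't) \<Rightarrow> 's set \<Rightarrow> ('t, 'q) quiver \<Rightarrow> ('s, 'q) quiver" where
  "pull f S Q = (\<lambda>a b. if a \<in> S \<and> b \<in> S then Q (f a) (f b) else {})"

definition pull_mult ::
  "('s \<Rightarrow> 't) \<Rightarrow> 's set \<Rightarrow> ('t, 'q) quiver \<Rightarrow> ('t, 'p) quiver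
    \<Rightarrow> ('s, 's \<times> 'q \<times> 'p, 't \<times> 'q \<times> 'p) quiver_map" where
  "pull_mult f S Q P =
    (\<lambda>a b. \<lambda>(c, q, p)\<in>tensor S (pull f S Q) (pull f S P) a b. (f c, q, p))"

definition pull_unit :: "('s \<Rightarrow> 't) \<Rightarrow> 's set \<Rightarrow> ('s, unit, unit) quiver_map" where
  "pull_unit f S = (\<lambda>a b. \<lambda>u\<in>unit_quiver S a b. ())"

definition push :: "('s \<Rightarrow> 't) \<Rightarrow> 's set \<Rightarrow> ('s, 'q) quiver \<Rightarrow> ('t, 's \<times> 's \<times> 'q) quiver" where
  "push f S Q = (\<lambda>x y. {(a, b, q). a \<in> S \<and> b \<in> S \<and> f a = x \<and> f b = y \<and> q \<in> Q a b})"

definition push_map ::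
  "('s \<Rightarrow> 't) \<Rightarrow> 's set \<Rightarrow> ('s, 'q) quiver \<Rightarrow> ('s, 'q, 'p) quiver_map
    \<Rightarrow> ('t, 's \<times> 's \<times> 'q, 's \<times> 's \<times> 'p) quiver_map" where
  "push_map f S Q \<phi> = (\<lambda>x y. \<lambda>(a, b, q)\<in>push f S Q x y. (a, b, \<phi> a b q))"

definition adj_unit ::
  "('s, 'q) quiver \<Rightarrow> ('s, 'q, 's \<times> 's \<times> 'q) quiver_map" where
  "adj_unit Q = (\<lambda>a b. \<lambda>q\<in>Q a b. (a, b, q))"

definition adj_counit ::
  "('s \<Rightarrow> 't) \<Rightarrow> 's set \<Rightarrow> ('t, 'q) quiver \<Rightarrow> ('t, 's \<times> 's \<times> 'q, 'q) quiver_map" where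
  "adj_counit f S Q = (\<lambda>x y. \<lambda>(a, b, q)\<in>push f S (pull f S Q) x y. q)"

text \<open>
  \<open>f\<^sub>!(Q \<otimes> P) \<rightarrow> f\<^sub>!(f\<^sup>*f\<^sub>!Q \<otimes> f\<^sup>*f\<^sub>!P) \<rightarrow> f\<^sub>!f\<^sup>*(f\<^sub>!Q \<otimes> f\<^sub>!P) \<rightarrow> f\<^sub>!Q \<otimes> f\<^sub>!P\<close>
\<close>

definition push_comult ::
  "('s \<Rightarrow> 't) \<Rightarrow> 's set \<Rightarrow> 't set \<Rightarrow> ('s, 'q) quiver \<Rightarrow> ('s, 'p) quiver
    \<Rightarrow> ('t, 's \<times> 's \<times> ('s \<times> 'q \<times> 'p), 't \<times> ('s \<times> 's \<times> 'q) \<times> ('s \<times> 's \<times> 'p)) quiver_map" where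
  "push_comult f S T Q P =
    quiv_comp (push f S (tensor S Q P))
      (adj_counit f S (tensor T (push f S Q) (push f S P)))
      (quiv_comp (push f S (tensor S Q P))
        (push_map f S (tensor S (pull f S (push f S Q)) (pull f S (push f S P)))
          (pull_mult f S (push f S Q) (push f S P)))
        (push_map f S (tensor S Q P) (tensor_map S Q P (adj_unit Q) (adj_unit P))))"

text \<open>\<open>f\<^sub>!I\<^sub>S \<rightarrow> f\<^sub>!f\<^sup>*I\<^sub>T \<rightarrow> I\<^sub>T\<close>\<close>

definition push_counit ::
  "('s \<Rightarrow> 't) \<Rightarrow> 's set \<Rightarrow> 't set \<Rightarrow> ('t, 's \<times> 's \<times> unit, unit) quiver_map" where
  "push_counit f S T =
    quiv_comp (push f S (unit_quiver S))
      (adj_counit f S (unit_quiver T))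
      (push_map f S (unit_quiver S) (pull_unit f S))"

text \<open>\<open>(gf)\<^sub>!Q \<rightarrow> g\<^sub>!f\<^sub>!Q\<close>\<close>

definition push_push ::
  "('t \<Rightarrow> 'w) \<Rightarrow> ('s \<Rightarrow> 't) \<Rightarrow> 's set \<Rightarrow> ('s, 'q) quiver
    \<Rightarrow> ('w, 's \<times> 's \<times> 'q, 't \<times> 't \<times> ('s \<times> 's \<times> 'q)) quiver_map" where
  "push_push g f S Q =
    (\<lambda>x y. \<lambda>(a, b, q)\<in>push (compose S g f) S Q x y. (f a, f b, (a, b, q)))"


section \<open>Templicial objects\<close>

text \<open>
  Functors from the opposite of \<open>Delta_f\<close> to quivers with a comultiplication
  \<open>X\<^bsub>m+n\<^esub> \<rightarrow> X\<^sub>m \<otimes> X\<^sub>n\<close> and a counit \<open>X\<^sub>0 \<rightarrow> I\<close>. In \<open>colax_monoidal\<close>, the associativity and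
  unit constraints of \<open>Delta_f\<close> are identities.
\<close>

record ('s, 'q) colax =
  "(nat, nat \<Rightarrow> nat, ('s, 'q) quiver, ('s, 'q, 'q) quiver_map) fctr" +
  comult :: "nat \<Rightarrow> nat \<Rightarrow> ('s, 'q, 's \<times> 'q \<times> 'q) quiver_map"
  counit :: "('s, 'q, unit) quiver_map"

locale colax_monoidal = cat_functor "op_cat Delta_f" "Quiv S" X
  for S :: "'s set" and X :: "('s, 'q) colax" +
  assumes comult_in_hom:
      "comult X m n \<in> quiv_hom (obj_map X (m + n)) (tensor S (obj_map X m) (obj_map X n))"
    and counit_in_hom: "counit X \<in> quiv_hom (obj_map X 0) (unit_quiver S)"
    and comult_natural: "\<lbrakk>f \<in> Hom Delta_f m m'; g \<in> Hom Delta_f n n'\<rbrakk>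
      \<Longrightarrow> quiv_comp (obj_map X (m' + n')) (comult X m n)
            (arr_map X (m' + n') (m + n) (Delta_f_add m m' n f g))
        = quiv_comp (obj_map X (m' + n'))
            (tensor_map S (obj_map X m') (obj_map X n') (arr_map X m' m f) (arr_map X n' n g))
            (comult X m' n')"
    and comult_assoc:
      "quiv_comp (obj_map X (l + m + n))
         (associator S (obj_map X l) (obj_map X m) (obj_map X n))
         (quiv_comp (obj_map X (l + m + n))
           (tensor_map S (obj_map X (l + m)) (obj_map X n) (comult X l m) (quiv_id (obj_map X n)))
           (comult X (l + m) n))
       = quiv_comp (obj_map X (l + (m + n)))
           (tensor_map S (obj_map X l) (obj_map X (m + n)) (quiv_id (obj_map X l)) (comult X m n))
           (comult X l (m + n))"
    and counit_left:
      "quiv_comp (obj_map X (0 + n)) (left_unitor S (obj_map X n))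
         (quiv_comp (obj_map X (0 + n))
           (tensor_map S (obj_map X 0) (obj_map X n) (counit X) (quiv_id (obj_map X n)))
           (comult X 0 n))
       = quiv_id (obj_map X n)"
    and counit_right:
      "quiv_comp (obj_map X (n + 0)) (right_unitor S (obj_map X n))
         (quiv_comp (obj_map X (n + 0))
           (tensor_map S (obj_map X n) (obj_map X 0) (quiv_id (obj_map X n)) (counit X))
           (comult X n 0))
       = quiv_id (obj_map X n)"

definition strongly_unital :: "'s set \<Rightarrow> ('s, 'q) colax \<Rightarrow> bool" where
  "strongly_unital S X \<longleftrightarrow> quiv_iso (obj_map X 0) (unit_quiver S) (counit X)"

definition push_colax ::
  "('s \<Rightarrow> 't) \<Rightarrow> 's set \<Rightarrow> 't set \<Rightarrow> ('s, 'q) colax \<Rightarrow> ('t, 's \<times> 's \<times> 'q) colax" where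
  "push_colax f S T X =
    \<lparr>obj_map = (\<lambda>n. push f S (obj_map X n)),
     arr_map = (\<lambda>m n h. push_map f S (obj_map X m) (arr_map X m n h)),
     comult = (\<lambda>m n. quiv_comp (push f S (obj_map X (m + n)))
       (push_comult f S T (obj_map X m) (obj_map X n))
       (push_map f S (obj_map X (m + n)) (comult X m n))),
     counit = quiv_comp (push f S (obj_map X 0))
       (push_counit f S T)
       (push_map f S (obj_map X 0) (counit X))\<rparr>"

locale monoidal_natural_transformation =
  X: colax_monoidal T X + Y: colax_monoidal T Y
  for T :: "'t set" and X :: "('t, 'q) colax" and Y :: "('t, 'p) colax" +
  fixes \<alpha> :: "nat \<Rightarrow> ('t, 'q, 'p) quiver_map"
  assumes component_in_hom: "\<alpha> n \<in> quiv_hom (obj_map X n) (obj_map Y n)"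
    and component_natural: "h \<in> Hom (op_cat Delta_f) m n
      \<Longrightarrow> quiv_comp (obj_map X m) (\<alpha> n) (arr_map X m n h)
        = quiv_comp (obj_map X m) (arr_map Y m n h) (\<alpha> m)"
    and component_comult:
      "quiv_comp (obj_map X (m + n))
         (tensor_map T (obj_map X m) (obj_map X n) (\<alpha> m) (\<alpha> n)) (comult X m n)
       = quiv_comp (obj_map X (m + n)) (comult Y m n) (\<alpha> (m + n))"
    and component_counit: "quiv_comp (obj_map X 0) (counit Y) (\<alpha> 0) = counit X"

text \<open>
  Both the base set and the quivers of a templicial set take their elements from the type \<open>'u\<close>.
  The identity of \<open>(X, S)\<close> is the identity of \<open>S\<close> together with the canonical isomorphism
  \<open>id\<^sub>!X \<rightarrow> X\<close>.
\<close>

type_synonym 'u templicial = "('u, 'u) colax \<times> 'u set"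
type_synonym 'u templicial_map =
  "(nat \<Rightarrow> ('u, 'u \<times> 'u \<times> 'u, 'u) quiver_map) \<times> ('u \<Rightarrow> 'u)"

definition TSet :: "('u templicial, 'u templicial_map) cat" where
  "TSet =
    \<lparr>Ob = {(X, S). colax_monoidal S X \<and> strongly_unital S X},
     Hom = (\<lambda>(X, S) (Y, T). {(\<alpha>, f). f \<in> S \<rightarrow>\<^sub>E T \<and>
       monoidal_natural_transformation T (push_colax f S T X) Y \<alpha>}),
     Id = (\<lambda>(X, S).
       (\<lambda>n x y. \<lambda>(a, b, q)\<in>push (\<lambda>a\<in>S. a) S (obj_map X n) x y. q, \<lambda>a\<in>S. a)),
     Comp = (\<lambda>(X, S) (Y, T) (Z, U) (\<beta>, g) (\<alpha>, f).
       (\<lambda>n. quiv_comp (push (compose S g f) S (obj_map X n))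
          (\<beta> n)
          (quiv_comp (push (compose S g f) S (obj_map X n))
            (push_map g T (push f S (obj_map X n)) (\<alpha> n))
            (push_push g f S (obj_map X n))),
        compose S g f))\<rparr>"

end

theory Submission
  imports Defs
begin

text \<open>
  A simplicial set \<open>K\<close> gives a templicial set on \<open>K\<^sub>0\<close>: let \<open>X\<^sub>n(a, b)\<close> be the set of \<open>n\<close>-simplices
  with first vertex \<open>a\<close> and last vertex \<open>b\<close>, and let the comultiplication send \<open>x \<in> X\<^bsub>m+n\<^esub>\<close> to its
  restrictions to \<open>{0..m}\<close> and \<open>{m..m+n}\<close>, which share the vertex \<open>m\<close>. Every map of \<open>Delta\<close> is
  a map of \<open>Delta_f\<close> followed by the inclusion of an interval, and restrictions to intervals are
  obtained by comultiplying and projecting. So this functor is fully faithful, and for every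
  templicial set the disjoint unions of the sets \<open>X\<^sub>n(a, b)\<close> over all \<open>a\<close> and \<open>b\<close> form a simplicial
  set, which maps to it up to isomorphism. As \<open>'u\<close> is infinite, these disjoint
  unions can be coded in \<open>'u\<close>.
\<close>

section \<open>Categories and equivalences\<close>

text \<open>A morphism of templicial sets is a transformation out of \<open>f_!X\<close>, whose
  comultiplication is only given as a mate. Transposed along the adjunction of \<open>push\<close>
  and \<open>pull\<close>, it becomes a family of maps \<open>X_n(a, b)\<close> \<rightarrow>
  \<open>Y_n(f a, f b)\<close> that respects the maps of \<open>Delta_f\<close> and all cuts. The
  counit adds no condition to such a family, because any two maps into a one-point set agree. Once
  this is proved, morphisms are handled only in this form. The delicate point of the inverse
  construction is functoriality. A composite of two maps of \<open>Delta\<close>, each factored,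
  contains an endpoint-preserving map followed by an interval inclusion in the wrong order, and the
  two have to be exchanged. Naturality of the comultiplication speaks only of sums of maps, but
  every map of \<open>Delta_f\<close> is the sum of its restrictions to the two sides of any vertex,
  so it covers all of them. Coassociativity makes nested cuts compose. Strong unitality puts exactly
  one 0-simplex over each point of \<open>S\<close>, so the vertices of the resulting simplicial set
  are \<open>S\<close> again.\<close>

lemma category_op:
  assumes "category C"
  shows "category (op_cat C)"
proof -
  interpret category C by fact
  show ?thesis
    by unfold_locales
      (auto simp: op_cat_def Id_in_Hom Comp_in_Hom Comp_Id_right Comp_Id_left Comp_assoc)
qed

lemma category_Set_cat: "category Set_cat"
  by unfold_locales
    (auto simp: Set_cat_def compose_def PiE_iff extensional_def fun_eq_iff)

lemma category_Delta: "category Delta"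
  by unfold_locales
    (auto simp: Delta_def compose_def PiE_iff extensional_def fun_eq_iff mono_on_def Pi_iff)

lemma category_Delta_f: "category Delta_f"
  by unfold_locales
    (auto simp: Delta_f_def Delta_def compose_def PiE_iff extensional_def fun_eq_iff mono_on_def Pi_iff)

lemma category_functor_category:
  assumes "category C" "category D"
  shows "category (functor_category C D)"
proof -
  interpret C: category C by fact
  interpret D: category D by fact
  let ?N = "\<lambda>F G \<tau>. natural_transformation C D F G \<tau>"
  have id: "?N F F (\<lambda>a\<in>Ob C. Id D (obj_map F a))" if "cat_functor C D F" for F
  proof -
    interpret cat_functor C D F by fact
    show ?thesis
      by unfold_locales
        (simp_all add: D.Id_in_Hom obj_map_in_Ob D.Comp_Id_left D.Comp_Id_right arr_map_in_Hom)
  qed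
  have comp: "?N F H (\<lambda>a\<in>Ob C. Comp D (obj_map F a) (obj_map G a) (obj_map H a) (\<tau> a) (\<sigma> a))"
    if s: "?N F G \<sigma>" and t: "?N G H \<tau>" for F G H \<sigma> \<tau>
  proof -
    interpret s: natural_transformation C D F G \<sigma> by fact
    interpret t: natural_transformation C D G H \<tau> by fact
    note mem = s.F.obj_map_in_Ob s.G.obj_map_in_Ob t.G.obj_map_in_Ob s.F.arr_map_in_Hom
      s.G.arr_map_in_Hom t.G.arr_map_in_Hom s.component_in_Hom t.component_in_Hom
    show ?thesis
    proof unfold_locales
      fix a b f assume h: "a \<in> Ob C" "b \<in> Ob C" "f \<in> Hom C a b"
      let ?c = "\<lambda>x y z. Comp D x y z"
      have "?c (obj_map F a) (obj_map F b) (obj_map H b)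
             (?c (obj_map F b) (obj_map G b) (obj_map H b) (\<tau> b) (\<sigma> b)) (arr_map F a b f)
          = ?c (obj_map F a) (obj_map G b) (obj_map H b) (\<tau> b)
             (?c (obj_map F a) (obj_map F b) (obj_map G b) (\<sigma> b) (arr_map F a b f))"
        by (rule D.Comp_assoc) (use h mem in auto)
      also have "\<dots> = ?c (obj_map F a) (obj_map G b) (obj_map H b) (\<tau> b)
             (?c (obj_map F a) (obj_map G a) (obj_map G b) (arr_map G a b f) (\<sigma> a))"
        using s.naturality[OF h] by simp
      also have "\<dots> = ?c (obj_map F a) (obj_map G a) (obj_map H b)
             (?c (obj_map G a) (obj_map G b) (obj_map H b) (\<tau> b) (arr_map G a b f)) (\<sigma> a)"
        by (rule D.Comp_assoc[symmetric]) (use h mem in auto)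
      also have "\<dots> = ?c (obj_map F a) (obj_map G a) (obj_map H b)
             (?c (obj_map G a) (obj_map H a) (obj_map H b) (arr_map H a b f) (\<tau> a)) (\<sigma> a)"
        using t.naturality[OF h] by simp
      also have "\<dots> = ?c (obj_map F a) (obj_map H a) (obj_map H b) (arr_map H a b f)
             (?c (obj_map F a) (obj_map G a) (obj_map H a) (\<tau> a) (\<sigma> a))"
        by (rule D.Comp_assoc) (use h mem in auto)
      finally show "?c (obj_map F a) (obj_map F b) (obj_map H b)
            ((\<lambda>a\<in>Ob C. ?c (obj_map F a) (obj_map G a) (obj_map H a) (\<tau> a) (\<sigma> a)) b) (arr_map F a b f)
          = ?c (obj_map F a) (obj_map H a) (obj_map H b) (arr_map H a b f)
            ((\<lambda>a\<in>Ob C. ?c (obj_map F a) (obj_map G a) (obj_map H a) (\<tau> a) (\<sigma> a)) a)"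
        using h by simp
    qed (use mem in \<open>auto intro!: D.Comp_in_Hom\<close>)
  qed
  note mem = cat_functor.obj_map_in_Ob natural_transformation.component_in_Hom
  show ?thesis
  proof (unfold_locales, goal_cases)
    case (3 F G \<tau>)
    then show ?case
      by (auto simp: functor_category_def fun_eq_iff restrict_def extensional_def
          intro!: D.Comp_Id_right mem)
  next
    case (4 F G \<tau>)
    then show ?case
      by (auto simp: functor_category_def fun_eq_iff restrict_def extensional_def
          intro!: D.Comp_Id_left mem)
  next
    case (5 F G H I \<tau> \<sigma> \<rho>)
    then show ?case
      by (auto simp: functor_category_def fun_eq_iff restrict_def
          intro!: D.Comp_assoc mem)
  qed (auto simp: functor_category_def intro: id comp)
qed

text \<open>Removes a pair with composite 1 from the middle of a fourfold composite. This is what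
  makes conjugation by chosen isomorphisms multiplicative.\<close>

lemma (in category) Comp_cancel:
  assumes "a \<in> Ob C" "b \<in> Ob C" "c \<in> Ob C" "d \<in> Ob C"
    "f \<in> Hom C a b" "p \<in> Hom C b d" "q \<in> Hom C d b" "g \<in> Hom C b c"
    "Comp C b d b q p = Id C b"
  shows "Comp C a d c (Comp C d b c g q) (Comp C a b d p f) = Comp C a b c g f"
proof -
  have "Comp C a d c (Comp C d b c g q) (Comp C a b d p f)
      = Comp C a b c g (Comp C a d b q (Comp C a b d p f))"
    using assms by (intro Comp_assoc) (auto intro: Comp_in_Hom)
  also have "Comp C a d b q (Comp C a b d p f) = Comp C a b b (Comp C b d b q p) f"
    using assms by (intro Comp_assoc[symmetric]) auto
  also have "\<dots> = f"
    using assms by (simp add: Comp_Id_left)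
  finally show ?thesis .
qed

text \<open>A fully faithful and essentially surjective functor has a quasi-inverse: choose for each
  \<open>c\<close> an object \<open>P c\<close> and an isomorphism \<open>u c\<close> from
  \<open>c\<close> to \<open>?G (P c)\<close> with inverse \<open>v c\<close>, and send
  \<open>f\<close> to the unique preimage under \<open>G\<close> of its conjugate. Then
  \<open>u\<close> is natural by construction.\<close>

lemma equivalent_categoriesI:
  fixes C :: "('o, 'm) cat" and D :: "('p, 'n) cat" and G :: "('p, 'n, 'o, 'm) fctr"
  assumes G: "cat_functor D C G"
    and ff: "\<And>x y. \<lbrakk>x \<in> Ob D; y \<in> Ob D\<rbrakk>
      \<Longrightarrow> bij_betw (arr_map G x y) (Hom D x y) (Hom C (obj_map G x) (obj_map G y))"
    and es: "\<And>c. c \<in> Ob C \<Longrightarrow> \<exists>d\<in>Ob D. \<exists>u. iso_in C c (obj_map G d) u"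
  shows "equivalent_categories C D"
proof -
  interpret G: cat_functor D C G by fact
  let ?G = "obj_map G"
  let ?h = "Hom C"
  have "\<forall>c. \<exists>d u v. c \<in> Ob C \<longrightarrow> d \<in> Ob D \<and> u \<in> ?h c (?G d) \<and> v \<in> ?h (?G d) c \<and>
      Comp C c (?G d) c v u = Id C c \<and> Comp C (?G d) c (?G d) u v = Id C (?G d)"
    using es unfolding iso_in_def by metis
  then obtain P u v where
    P: "\<And>c. c \<in> Ob C \<Longrightarrow> P c \<in> Ob D"
    and u: "\<And>c. c \<in> Ob C \<Longrightarrow> u c \<in> ?h c (?G (P c))"
    and v: "\<And>c. c \<in> Ob C \<Longrightarrow> v c \<in> ?h (?G (P c)) c"
    and vu: "\<And>c. c \<in> Ob C \<Longrightarrow> Comp C c (?G (P c)) c (v c) (u c) = Id C c"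
    and uv: "\<And>c. c \<in> Ob C \<Longrightarrow> Comp C (?G (P c)) c (?G (P c)) (u c) (v c) = Id C (?G (P c))"
    by metis
  define pre where "pre x y m = inv_into (Hom D x y) (arr_map G x y) m" for x y m
  have pre_in: "pre x y m \<in> Hom D x y"
    and G_pre: "arr_map G x y (pre x y m) = m"
    if "x \<in> Ob D" "y \<in> Ob D" "m \<in> ?h (?G x) (?G y)" for x y m
    using ff[OF that(1,2)] that(3)
    by (auto simp: pre_def bij_betw_def inv_into_into f_inv_into_f)
  have faithful: "f = g" if "x \<in> Ob D" "y \<in> Ob D" "f \<in> Hom D x y" "g \<in> Hom D x y"
    "arr_map G x y f = arr_map G x y g" for x y f g
    using ff[OF that(1,2)] that(3-) by (auto simp: bij_betw_def inj_on_def)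
  define conj where "conj a b f = Comp C (?G (P a)) b (?G (P b)) (u b) (Comp C (?G (P a)) a b f (v a))" for a b f
  have GP: "?G (P c) \<in> Ob C" if "c \<in> Ob C" for c
    using that P G.obj_map_in_Ob by blast
  note mem = P u v GP G.obj_map_in_Ob G.arr_map_in_Hom
  have fv: "Comp C (?G (P a)) a b f (v a) \<in> ?h (?G (P a)) b"
    if "a \<in> Ob C" "b \<in> Ob C" "f \<in> ?h a b" for a b f
    using that mem by (auto intro!: G.B.Comp_in_Hom)
  have conj_in: "conj a b f \<in> ?h (?G (P a)) (?G (P b))"
    if "a \<in> Ob C" "b \<in> Ob C" "f \<in> ?h a b" for a b f
    unfolding conj_def using that mem fv by (auto intro!: G.B.Comp_in_Hom)
  have conj_Id: "conj a a (Id C a) = Id C (?G (P a))" if "a \<in> Ob C" for a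
    using that mem by (simp add: conj_def G.B.Comp_Id_left uv)
  have conj_Comp: "conj a c (Comp C a b c g f) = Comp C (?G (P a)) (?G (P b)) (?G (P c)) (conj b c g) (conj a b f)"
    if h: "a \<in> Ob C" "b \<in> Ob C" "c \<in> Ob C" "f \<in> ?h a b" "g \<in> ?h b c" for a b c f g
  proof -
    \<comment> \<open>This bracketing puts \<open>v b\<close> next to \<open>u b\<close>, where
      \<open>Comp_cancel\<close> removes both.\<close>
    have "conj b c g = Comp C (?G (P b)) b (?G (P c)) (Comp C b c (?G (P c)) (u c) g) (v b)"
      unfolding conj_def using h mem by (intro G.B.Comp_assoc[symmetric]) auto
    then have "Comp C (?G (P a)) (?G (P b)) (?G (P c)) (conj b c g) (conj a b f)
      = Comp C (?G (P a)) b (?G (P c)) (Comp C b c (?G (P c)) (u c) g) (Comp C (?G (P a)) a b f (v a))"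
      unfolding conj_def[of a b] using h mem fv vu
      by (simp, intro G.B.Comp_cancel) (auto intro!: G.B.Comp_in_Hom)
    also have "\<dots> = Comp C (?G (P a)) c (?G (P c)) (u c) (Comp C (?G (P a)) b c g (Comp C (?G (P a)) a b f (v a)))"
      using h mem fv by (intro G.B.Comp_assoc) auto
    also have "Comp C (?G (P a)) b c g (Comp C (?G (P a)) a b f (v a)) = Comp C (?G (P a)) a c (Comp C a b c g f) (v a)"
      using h mem by (intro G.B.Comp_assoc[symmetric]) auto
    finally show ?thesis by (simp add: conj_def)
  qed
  define F where "F = \<lparr>obj_map = P, arr_map = (\<lambda>a b f. pre (P a) (P b) (conj a b f))\<rparr>"
  have F: "cat_functor C D F"
  proof unfold_locales
    fix a assume a: "a \<in> Ob C"
    show "obj_map F a \<in> Ob D" using a P by (simp add: F_def)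
    show "arr_map F a a (Id C a) = Id D (obj_map F a)"
      by (rule faithful[of "P a" "P a"])
        (use a mem in \<open>simp_all add: F_def conj_Id pre_in G_pre G.B.Id_in_Hom G.A.Id_in_Hom G.arr_map_Id\<close>)
  next
    fix a b f assume "a \<in> Ob C" "b \<in> Ob C" "f \<in> ?h a b"
    then show "arr_map F a b f \<in> Hom D (obj_map F a) (obj_map F b)"
      by (simp add: F_def pre_in conj_in P)
  next
    fix a b c f g assume h: "a \<in> Ob C" "b \<in> Ob C" "c \<in> Ob C" "f \<in> ?h a b" "g \<in> ?h b c"
    note k = pre_in[OF P[OF h(1)] P[OF h(2)] conj_in[OF h(1,2,4)]]
      pre_in[OF P[OF h(2)] P[OF h(3)] conj_in[OF h(2,3,5)]] G.B.Comp_in_Hom[OF h]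
    have "arr_map G (P a) (P c) (pre (P a) (P c) (conj a c (Comp C a b c g f))) =
      arr_map G (P a) (P c) (Comp D (P a) (P b) (P c) (pre (P b) (P c) (conj b c g)) (pre (P a) (P b) (conj a b f)))"
      using h k conj_in[OF h(1,3) k(3)]
      by (subst G.arr_map_Comp) (simp_all add: P G_pre conj_in conj_Comp[symmetric])
    then show "arr_map F a c (Comp C a b c g f)
      = Comp D (obj_map F a) (obj_map F b) (obj_map F c) (arr_map F b c g) (arr_map F a b f)"
      using h k by (simp add: F_def) (rule faithful[of "P a" "P c"],
        auto intro!: P pre_in conj_in G.A.Comp_in_Hom)
  qed
  interpret F: cat_functor C D F by fact
  have 1: "natural_isomorphism C C id_functor (comp_functor G F) u"
    unfolding natural_isomorphism_def
  proof (intro conjI ballI)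
    show "natural_transformation C C id_functor (comp_functor G F) u"
    proof (unfold_locales, goal_cases)
      case (10 a b f)
      then have "conj a b f = Comp C (?G (P a)) a (?G (P b)) (Comp C a b (?G (P b)) (u b) f) (v a)"
        unfolding conj_def using mem by (intro G.B.Comp_assoc[symmetric]) auto
      then have "Comp C a (?G (P a)) (?G (P b)) (conj a b f) (u a)
        = Comp C a a (?G (P b)) (Comp C a b (?G (P b)) (u b) f) (Comp C a (?G (P a)) a (v a) (u a))"
        using 10 mem by (simp, intro G.B.Comp_assoc) (auto intro!: G.B.Comp_in_Hom)
      also have "\<dots> = Comp C a b (?G (P b)) (u b) f"
        using 10 mem by (simp add: vu) (intro G.B.Comp_Id_right, auto intro!: G.B.Comp_in_Hom)
      finally show ?case
        using 10 by (simp add: id_functor_def comp_functor_def F_def P G_pre conj_in)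
    qed (auto simp: id_functor_def comp_functor_def F_def mem G_pre pre_in conj_in conj_Id conj_Comp
        G.B.Comp_in_Hom G.B.Id_in_Hom)
    show "iso_in C (obj_map id_functor a) (obj_map (comp_functor G F) a) (u a)" if "a \<in> Ob C" for a
      using that u v uv vu
      by (auto simp: iso_in_def id_functor_def comp_functor_def F_def intro!: bexI[of _ "v a"])
  qed
  \<comment> \<open>Fullness lifts \<open>v (?G d)\<close> to a map in \<open>D\<close>. Naturality
    and invertibility of \<open>e\<close> are checked on images under \<open>G\<close>, which
    suffices by faithfulness.\<close>
  define e where "e d = pre (P (?G d)) d (v (?G d))" for d
  have e_in: "e d \<in> Hom D (P (?G d)) d" and Ge: "arr_map G (P (?G d)) d (e d) = v (?G d)"
    if "d \<in> Ob D" for d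
    using that by (simp_all add: e_def pre_in G_pre mem)
  have 2: "natural_isomorphism D D (comp_functor F G) id_functor e"
    unfolding natural_isomorphism_def
  proof (intro conjI ballI)
    show "natural_transformation D D (comp_functor F G) id_functor e"
    proof (unfold_locales, goal_cases)
      case (10 a b f)
      have Gf: "arr_map G a b f \<in> ?h (?G a) (?G b)" using 10 by (simp add: mem)
      have p: "pre (P (?G a)) (P (?G b)) (conj (?G a) (?G b) (arr_map G a b f)) \<in> Hom D (P (?G a)) (P (?G b))"
        using 10 Gf by (intro pre_in conj_in) (auto simp: mem)
      have "arr_map G (P (?G a)) b (Comp D (P (?G a)) (P (?G b)) b (e b) (pre (P (?G a)) (P (?G b)) (conj (?G a) (?G b) (arr_map G a b f))))
         = Comp C (?G (P (?G a))) (?G (P (?G b))) (?G b) (v (?G b)) (conj (?G a) (?G b) (arr_map G a b f))"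
        using 10 p Gf by (subst G.arr_map_Comp) (simp_all add: mem e_in Ge G_pre conj_in)
      also have "\<dots> = Comp C (?G (P (?G a))) (?G b) (?G b)
          (Comp C (?G b) (?G (P (?G b))) (?G b) (v (?G b)) (u (?G b))) (Comp C (?G (P (?G a))) (?G a) (?G b) (arr_map G a b f) (v (?G a)))"
        unfolding conj_def using 10 Gf fv by (intro G.B.Comp_assoc[symmetric]) (auto simp: mem)
      also have "\<dots> = Comp C (?G (P (?G a))) (?G a) (?G b) (arr_map G a b f) (v (?G a))"
        using 10 Gf fv by (simp add: vu mem G.B.Comp_Id_left)
      also have "\<dots> = arr_map G (P (?G a)) b (Comp D (P (?G a)) a b f (e a))"
        using 10 by (subst G.arr_map_Comp) (simp_all add: mem e_in Ge)
      finally have "Comp D (P (?G a)) (P (?G b)) b (e b) (pre (P (?G a)) (P (?G b)) (conj (?G a) (?G b) (arr_map G a b f)))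
         = Comp D (P (?G a)) a b f (e a)"
        using 10 p e_in by (intro faithful[of "P (?G a)" b]) (auto intro!: G.A.Comp_in_Hom simp: mem)
      then show ?case
        by (simp add: id_functor_def comp_functor_def F_def)
    next
      case 9
      then show ?case using e_in by (simp add: id_functor_def comp_functor_def F_def)
    qed (auto simp: id_functor_def comp_functor_def mem G.A.Comp_in_Hom
        F.obj_map_in_Ob F.arr_map_in_Hom F.arr_map_Id F.arr_map_Comp G.arr_map_Id G.arr_map_Comp)
    show "iso_in D (obj_map (comp_functor F G) d) (obj_map id_functor d) (e d)" if d: "d \<in> Ob D" for d
    proof -
      let ?i = "pre d (P (?G d)) (u (?G d))"
      have i: "?i \<in> Hom D d (P (?G d))" "arr_map G d (P (?G d)) ?i = u (?G d)"
        using d by (simp_all add: pre_in G_pre mem)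
      have "Comp D (P (?G d)) d (P (?G d)) ?i (e d) = Id D (P (?G d))"
        using d i by (intro faithful[of "P (?G d)" "P (?G d)"])
          (auto intro!: G.A.Comp_in_Hom simp: mem e_in G.A.Id_in_Hom G.arr_map_Comp G.arr_map_Id Ge uv)
      moreover have "Comp D d (P (?G d)) d (e d) ?i = Id D d"
        using d i by (intro faithful[of d d])
          (auto intro!: G.A.Comp_in_Hom simp: mem e_in G.A.Id_in_Hom G.arr_map_Comp G.arr_map_Id Ge vu)
      ultimately show ?thesis
        using d i e_in
        by (auto simp: iso_in_def comp_functor_def id_functor_def F_def intro!: bexI[of _ ?i])
    qed
  qed
  from F G 1 2 show ?thesis
    unfolding equivalent_categories_def by blast
qed

section \<open>Colax monoidal functors elementwise\<close>

lemma category_Quiv: "category (Quiv S)"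
  by unfold_locales
    (auto simp: Quiv_def quiv_hom_def quiv_id_def quiv_comp_def compose_def PiE_iff
      extensional_def fun_eq_iff)

lemma quiv_comp_apply: "quiv_comp Q \<psi> \<phi> a b q = (if q \<in> Q a b then \<psi> a b (\<phi> a b q) else undefined)"
  by (simp add: quiv_comp_def compose_def)

lemma quiv_comp_eq_iff:
  "quiv_comp Q \<psi> \<phi> = quiv_comp Q \<psi>' \<phi>' \<longleftrightarrow>
    (\<forall>a b. \<forall>q\<in>Q a b. \<psi> a b (\<phi> a b q) = \<psi>' a b (\<phi>' a b q))"
  by (auto simp: fun_eq_iff quiv_comp_apply)

lemma quiv_comp_eq_id_iff:
  "quiv_comp Q \<psi> \<phi> = quiv_id Q \<longleftrightarrow> (\<forall>a b. \<forall>q\<in>Q a b. \<psi> a b (\<phi> a b q) = q)"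
  by (auto simp: fun_eq_iff quiv_comp_apply quiv_id_def)

lemma quiv_homD: "\<lbrakk>\<phi> \<in> quiv_hom Q P; q \<in> Q a b\<rbrakk> \<Longrightarrow> \<phi> a b q \<in> P a b"
  by (auto simp: quiv_hom_def)

lemma quiv_hom_eqI:
  assumes "\<phi> \<in> quiv_hom Q P" "\<psi> \<in> quiv_hom Q P'" "\<And>a b q. q \<in> Q a b \<Longrightarrow> \<phi> a b q = \<psi> a b q"
  shows "\<phi> = \<psi>"
proof (intro ext)
  fix a b q
  show "\<phi> a b q = \<psi> a b q"
    using assms by (cases "q \<in> Q a b") (auto simp: quiv_hom_def PiE_iff extensional_def)
qed

lemma quiv_id_in_hom: "quiv_id Q \<in> quiv_hom Q Q"
  by (auto simp: quiv_hom_def quiv_id_def)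

lemma quiv_comp_in_hom:
  "\<lbrakk>\<phi> \<in> quiv_hom Q P; \<psi> \<in> quiv_hom P R\<rbrakk> \<Longrightarrow> quiv_comp Q \<psi> \<phi> \<in> quiv_hom Q R"
  by (auto simp: quiv_hom_def quiv_comp_def compose_def PiE_iff)

lemma quiv_hom_restrictI:
  "(\<And>a b q. q \<in> Q a b \<Longrightarrow> \<phi> a b q \<in> P a b) \<Longrightarrow> (\<lambda>a b. \<lambda>q\<in>Q a b. \<phi> a b q) \<in> quiv_hom Q P"
  by (auto simp: quiv_hom_def)

lemma mem_tensor: "(c, y, z) \<in> tensor S Q P a b \<longleftrightarrow> c \<in> S \<and> y \<in> Q a c \<and> z \<in> P c b"
  by (simp add: tensor_def)

lemma mem_push: "(a, b, q) \<in> push f S Q x y \<longleftrightarrow> a \<in> S \<and> b \<in> S \<and> f a = x \<and> f b = y \<and> q \<in> Q a b"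
  by (simp add: push_def)

lemma mem_unit_quiver: "u \<in> unit_quiver S a b \<longleftrightarrow> a \<in> S \<and> a = b"
  by (auto simp: unit_quiver_def)

lemma Delta_f_add_in_Hom:
  assumes "f \<in> Hom Delta_f m m'" "g \<in> Hom Delta_f n n'"
  shows "Delta_f_add m m' n f g \<in> Hom Delta_f (m + n) (m' + n')"
proof -
  have f: "f \<in> {0..m} \<rightarrow>\<^sub>E {0..m'}" "mono_on {0..m} f" "f 0 = 0" "f m = m'"
    and g: "g \<in> {0..n} \<rightarrow>\<^sub>E {0..n'}" "mono_on {0..n} g" "g 0 = 0" "g n = n'"
    using assms by (auto simp: Delta_f_def Delta_def)
  have f1: "f i \<le> m'" if "i \<le> m" for i
    using f(1) that by (auto simp: PiE_iff)
  have g1: "g i \<le> n'" if "i \<le> n" for i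
    using g(1) that by (auto simp: PiE_iff)
  have "mono_on {0..m + n} (Delta_f_add m m' n f g)"
  proof (rule mono_onI)
    fix i j assume "i \<in> {0..m + n}" "j \<in> {0..m + n}" "i \<le> j"
    then show "Delta_f_add m m' n f g i \<le> Delta_f_add m m' n f g j"
      using f1 mono_onD[OF f(2), of i j] mono_onD[OF g(2), of "i - m" "j - m"]
      by (auto simp: Delta_f_add_def intro: trans_le_add1)
  qed
  moreover have "Delta_f_add m m' n f g \<in> {0..m + n} \<rightarrow>\<^sub>E {0..m' + n'}"
    using f1[THEN trans_le_add1] g1 by (auto simp: Delta_f_add_def)
  ultimately show ?thesis
    using f g by (auto simp: Delta_f_def Delta_def Delta_f_add_def)
qed

text \<open>Turns equations between composites of quiver maps into equations between the components
  of single cuts \<open>(c, y, z)\<close>. A map into \<open>unit\<close> carries no data, so all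
  that the counit contributes is that \<open>X_0(a, b)\<close> is empty for
  \<open>a \<noteq> b\<close>, which is \<open>zero\<close>; in the unit laws \<open>zero\<close>
  also fixes the middle index \<open>c\<close>. Associativity is asked for starting from one
  bracketing; the other cut is then determined, because \<open>comult X\<close> is a
  function.\<close>

lemma colax_monoidalI:
  fixes X :: "('s, 'q) colax"
  assumes quiver: "\<And>n. quiver_on S (obj_map X n)"
    and arr_hom: "\<And>m n h. h \<in> Hom Delta_f n m \<Longrightarrow> arr_map X m n h \<in> quiv_hom (obj_map X m) (obj_map X n)"
    and arr_id: "\<And>n a b x. x \<in> obj_map X n a b \<Longrightarrow> arr_map X n n (\<lambda>i\<in>{0..n}. i) a b x = x"
    and arr_comp: "\<And>l m n h g a b x. \<lbrakk>h \<in> Hom Delta_f m l; g \<in> Hom Delta_f n m; x \<in> obj_map X l a b\<rbrakk>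
      \<Longrightarrow> arr_map X l n (compose {0..n} h g) a b x = arr_map X m n g a b (arr_map X l m h a b x)"
    and comult_hom: "\<And>m n. comult X m n \<in> quiv_hom (obj_map X (m + n)) (tensor S (obj_map X m) (obj_map X n))"
    and zero: "\<And>a b x. x \<in> obj_map X 0 a b \<Longrightarrow> a = b"
    and nat: "\<And>m m' n n' f g a b c x y z.
      \<lbrakk>f \<in> Hom Delta_f m m'; g \<in> Hom Delta_f n n'; x \<in> obj_map X (m' + n') a b; comult X m' n' a b x = (c, y, z)\<rbrakk>
      \<Longrightarrow> comult X m n a b (arr_map X (m' + n') (m + n) (Delta_f_add m m' n f g) a b x)
        = (c, arr_map X m' m f a c y, arr_map X n' n g c b z)"
    and assoc: "\<And>l m n a b c d x u r q p.
      \<lbrakk>x \<in> obj_map X (l + m + n) a b; comult X (l + m) n a b x = (d, u, r); comult X l m a d u = (c, q, p)\<rbrakk>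
      \<Longrightarrow> \<exists>w. comult X l (m + n) a b x = (c, q, w) \<and> comult X m n c b w = (d, p, r)"
    and left: "\<And>n a b c x u q. \<lbrakk>x \<in> obj_map X n a b; comult X 0 n a b x = (c, u, q)\<rbrakk> \<Longrightarrow> q = x"
    and right: "\<And>n a b c x u q. \<lbrakk>x \<in> obj_map X n a b; comult X n 0 a b x = (c, q, u)\<rbrakk> \<Longrightarrow> q = x"
  shows "colax_monoidal S X"
proof -
  interpret D: category "op_cat Delta_f"
    by (intro category_op category_Delta_f)
  interpret Q: category "Quiv S"
    by (rule category_Quiv)
  have S: "a \<in> S" "b \<in> S" if "x \<in> obj_map X n a b" for n a b x
    using quiver[of n] that by (auto simp: quiver_on_def)
  \<comment> \<open>Extensionality outside \<open>obj_map X 0 a b\<close> is automatic, since even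
    \<open>undefined\<close> equals \<open>()\<close> in the type \<open>unit\<close>.\<close>
  have counit: "counit X \<in> quiv_hom (obj_map X 0) (unit_quiver S)"
    using zero S by (auto simp: quiv_hom_def unit_quiver_def PiE_iff extensional_def)
  have comultE: "\<exists>c y z. comult X m n a b x = (c, y, z) \<and> c \<in> S \<and> y \<in> obj_map X m a c \<and> z \<in> obj_map X n c b"
    if "x \<in> obj_map X (m + n) a b" for m n a b x
    using quiv_homD[where P = "tensor S (obj_map X m) (obj_map X n)", OF comult_hom that]
    by (auto simp: tensor_def)
  have cf: "cat_functor (op_cat Delta_f) (Quiv S) X"
  proof (unfold_locales, goal_cases)
    case (1 a)
    then show ?case by (simp add: Quiv_def quiver)
  next
    case (2 a b f)
    then show ?case by (simp add: Quiv_def op_cat_def arr_hom)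
  next
    case (3 n)
    have "(\<lambda>i\<in>{0..n}. i) \<in> Hom Delta_f n n"
      using category.Id_in_Hom[OF category_Delta_f, of n] by (simp add: Delta_f_def Delta_def)
    from quiv_hom_eqI[OF arr_hom[OF this] quiv_id_in_hom] arr_id show ?case
      by (simp add: op_cat_def Delta_f_def Delta_def Quiv_def quiv_id_def)
  next
    case (4 l m n h g)
    then have hg: "h \<in> Hom Delta_f m l" "g \<in> Hom Delta_f n m"
      by (auto simp: op_cat_def)
    have "compose {0..n} h g \<in> Hom Delta_f n l"
      using category.Comp_in_Hom[OF category_Delta_f _ _ _ hg(2,1)] by (simp add: Delta_f_def Delta_def)
    from quiv_hom_eqI[OF arr_hom[OF this] quiv_comp_in_hom[OF arr_hom[OF hg(1)] arr_hom[OF hg(2)]]]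
      arr_comp[OF hg] show ?case
      by (simp add: op_cat_def Delta_f_def Delta_def Quiv_def quiv_comp_apply)
  qed
  show ?thesis
  proof (intro colax_monoidal.intro cf colax_monoidal_axioms.intro counit comult_hom, goal_cases)
    case (1 f m m' g n n')
    have "comult X m n a b (arr_map X (m' + n') (m + n) (Delta_f_add m m' n f g) a b x) =
      tensor_map S (obj_map X m') (obj_map X n') (arr_map X m' m f) (arr_map X n' n g) a b
               (comult X m' n' a b x)" if x: "x \<in> obj_map X (m' + n') a b" for a b x
      using comultE[OF x] nat[OF 1 x] by (auto simp: tensor_map_def mem_tensor)
    then show ?case by (simp add: quiv_comp_eq_iff)
  next
    case (2 l m n)
    have "associator S (obj_map X l) (obj_map X m) (obj_map X n) a b
       (tensor_map S (obj_map X (l + m)) (obj_map X n) (comult X l m) (quiv_id (obj_map X n)) a b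
           (comult X (l + m) n a b x)) =
       tensor_map S (obj_map X l) (obj_map X (m + n)) (quiv_id (obj_map X l)) (comult X m n) a b
           (comult X l (m + n) a b x)" if x: "x \<in> obj_map X (l + m + n) a b" for a b x
    proof -
      obtain d u r where 1: "comult X (l + m) n a b x = (d, u, r)" "d \<in> S" "u \<in> obj_map X (l + m) a d" "r \<in> obj_map X n d b"
        using comultE[OF x] by auto
      obtain c q p where 2: "comult X l m a d u = (c, q, p)" "c \<in> S" "q \<in> obj_map X l a c" "p \<in> obj_map X m c d"
        using comultE[OF 1(3)] by auto
      obtain w where w: "comult X l (m + n) a b x = (c, q, w)" "comult X m n c b w = (d, p, r)"
        using assoc[OF x 1(1) 2(1)] by blast
      have "w \<in> obj_map X (m + n) c b"
        using comultE[of x l "m + n" a b] x w by (auto simp: add.assoc)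
      with 1 2 w show ?thesis
        by (simp add: associator_def tensor_map_def quiv_id_def mem_tensor)
    qed
    then show ?case
      unfolding add.assoc[of l m n] by (simp add: quiv_comp_eq_iff quiv_comp_apply)
  next
    case (3 n)
    have "left_unitor S (obj_map X n) a b (tensor_map S (obj_map X 0) (obj_map X n) (counit X) (quiv_id (obj_map X n)) a b
       (comult X 0 n a b x)) = x" if x: "x \<in> obj_map X n a b" for a b x
    proof -
      obtain c y z where 1: "comult X 0 n a b x = (c, y, z)" "c \<in> S" "y \<in> obj_map X 0 a c" "z \<in> obj_map X n c b"
        using comultE[of x 0 n a b] x by auto
      with left[OF x 1(1)] zero[OF 1(3)] x show ?thesis
        by (simp add: left_unitor_def tensor_map_def quiv_id_def mem_tensor mem_unit_quiver)
    qed
    then show ?case by (simp add: quiv_comp_eq_id_iff quiv_comp_apply)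
  next
    case (4 n)
    have "right_unitor S (obj_map X n) a b (tensor_map S (obj_map X n) (obj_map X 0) (quiv_id (obj_map X n)) (counit X) a b
       (comult X n 0 a b x)) = x" if x: "x \<in> obj_map X n a b" for a b x
    proof -
      obtain c y z where 1: "comult X n 0 a b x = (c, y, z)" "c \<in> S" "y \<in> obj_map X n a c" "z \<in> obj_map X 0 c b"
        using comultE[of x n 0 a b] x by auto
      with right[OF x 1(1)] zero[OF 1(4)] x show ?thesis
        by (simp add: right_unitor_def tensor_map_def quiv_id_def mem_tensor mem_unit_quiver)
    qed
    then show ?case by (simp add: quiv_comp_eq_id_iff quiv_comp_apply)
  qed
qed

section \<open>The axioms of a colax monoidal functor on elements, and its pushforward\<close>

context colax_monoidal
begin

lemma mem_base: "x \<in> obj_map X n a b \<Longrightarrow> a \<in> S \<and> b \<in> S"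
  using obj_map_in_Ob[of n] by (auto simp: op_cat_def Delta_f_def Delta_def Quiv_def quiver_on_def)

lemma arr_hom: "h \<in> Hom Delta_f n m \<Longrightarrow> arr_map X m n h \<in> quiv_hom (obj_map X m) (obj_map X n)"
  using arr_map_in_Hom[of m n h] by (auto simp: op_cat_def Delta_f_def Delta_def Quiv_def)

lemma arr_in: "\<lbrakk>h \<in> Hom Delta_f n m; x \<in> obj_map X m a b\<rbrakk> \<Longrightarrow> arr_map X m n h a b x \<in> obj_map X n a b"
  by (rule quiv_homD[OF arr_hom])

lemma arr_id: "x \<in> obj_map X n a b \<Longrightarrow> arr_map X n n (\<lambda>i\<in>{0..n}. i) a b x = x"
  using arr_map_Id[of n] by (auto simp: op_cat_def Delta_f_def Delta_def Quiv_def quiv_id_def)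

lemma arr_comp:
  "\<lbrakk>h \<in> Hom Delta_f m l; g \<in> Hom Delta_f n m; x \<in> obj_map X l a b\<rbrakk>
      \<Longrightarrow> arr_map X l n (compose {0..n} h g) a b x = arr_map X m n g a b (arr_map X l m h a b x)"
  using arr_map_Comp[of l m n h g]
  by (auto simp: op_cat_def Delta_f_def Delta_def Quiv_def quiv_comp_apply)

lemma comult_mem:
  assumes "x \<in> obj_map X (m + n) a b" "comult X m n a b x = (c, y, z)"
  shows "c \<in> S" "y \<in> obj_map X m a c" "z \<in> obj_map X n c b"
  using quiv_homD[where P = "tensor S (obj_map X m) (obj_map X n)", OF comult_in_hom assms(1)] assms(2)
  by (auto simp: tensor_def)

lemma zero_eq: "x \<in> obj_map X 0 a b \<Longrightarrow> a = b"
  using quiv_homD[OF counit_in_hom, of x a b] by (simp add: mem_unit_quiver)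

lemma comult_arr:
  assumes "f \<in> Hom Delta_f m m'" "g \<in> Hom Delta_f n n'" "x \<in> obj_map X (m' + n') a b"
    "comult X m' n' a b x = (c, y, z)"
  shows "comult X m n a b (arr_map X (m' + n') (m + n) (Delta_f_add m m' n f g) a b x)
        = (c, arr_map X m' m f a c y, arr_map X n' n g c b z)"
  using comult_natural[OF assms(1,2)] assms(3,4) comult_mem[OF assms(3,4)]
  by (auto simp: quiv_comp_eq_iff tensor_map_def mem_tensor)

lemma comult_comult:
  assumes x: "x \<in> obj_map X (l + m + n) a b" and 1: "comult X (l + m) n a b x = (d, u, r)"
    and 2: "comult X l m a d u = (c, q, p)"
  shows "\<exists>w. comult X l (m + n) a b x = (c, q, w) \<and> comult X m n c b w = (d, p, r)"
proof -
  obtain c' q' w where w: "comult X l (m + n) a b x = (c', q', w)"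
    using prod_cases3 by blast
  obtain d' p' r' where w': "comult X m n c' b w = (d', p', r')"
    using prod_cases3 by blast
  have x': "x \<in> obj_map X (l + (m + n)) a b" using x by (simp add: add.assoc)
  show ?thesis
    using comult_assoc[of l m n, unfolded add.assoc[of l m n] quiv_comp_eq_iff, rule_format, OF x']
      x x' 1 2 w w' comult_mem[OF x 1] comult_mem[OF x' w] comult_mem[OF comult_mem(2)[OF x 1] 2]
      comult_mem[OF comult_mem(3)[OF x' w] w']
    by (auto simp: quiv_comp_apply associator_def tensor_map_def quiv_id_def mem_tensor)
qed

lemma comult_0_left:
  assumes "x \<in> obj_map X n a b" "comult X 0 n a b x = (c, u, q)" shows "c = a" "q = x"
proof -
  have x: "x \<in> obj_map X (0 + n) a b" using assms by simp
  note m = comult_mem[OF x assms(2)]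
  show "c = a" using zero_eq[OF m(2)] by simp
  then show "q = x"
    using counit_left[of n, unfolded add_0_left quiv_comp_eq_id_iff, rule_format, of x a b] assms m
    by (auto simp: quiv_comp_apply left_unitor_def tensor_map_def quiv_id_def mem_tensor mem_unit_quiver)
qed

lemma comult_0_right:
  assumes "x \<in> obj_map X n a b" "comult X n 0 a b x = (c, q, u)" shows "c = b" "q = x"
proof -
  have x: "x \<in> obj_map X (n + 0) a b" using assms by simp
  note m = comult_mem[OF x assms(2)]
  show "c = b" using zero_eq[OF m(3)] by simp
  then show "q = x"
    using counit_right[of n, unfolded add_0_right quiv_comp_eq_id_iff, rule_format, of x a b] assms m
    by (auto simp: quiv_comp_apply right_unitor_def tensor_map_def quiv_id_def mem_tensor mem_unit_quiver)
qed

text \<open>The counit already forces \<open>X_0(a, b)\<close> to be empty off the diagonal, where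
  the unit quiver is empty too. So only the diagonal matters, and there the unit quiver has one
  element.\<close>

lemma strongly_unital_iff: "strongly_unital S X \<longleftrightarrow> (\<forall>a\<in>S. \<exists>u. obj_map X 0 a a = {u})"
proof
  assume "strongly_unital S X"
  then obtain \<psi> where \<psi>: "\<psi> \<in> quiv_hom (unit_quiver S) (obj_map X 0)"
    "quiv_comp (obj_map X 0) \<psi> (counit X) = quiv_id (obj_map X 0)"
    by (auto simp: strongly_unital_def quiv_iso_def)
  show "\<forall>a\<in>S. \<exists>u. obj_map X 0 a a = {u}"
  proof
    fix a assume "a \<in> S"
    then have "\<psi> a a () \<in> obj_map X 0 a a"
      using quiv_homD[OF \<psi>(1), of "()" a a] by (simp add: mem_unit_quiver)
    moreover have "q = \<psi> a a ()" if "q \<in> obj_map X 0 a a" for q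
    proof -
      have "\<psi> a a (counit X a a q) = q"
        using \<psi>(2) that unfolding quiv_comp_eq_id_iff by blast
      then show ?thesis by simp
    qed
    ultimately show "\<exists>u. obj_map X 0 a a = {u}" by blast
  qed
next
  assume "\<forall>a\<in>S. \<exists>u. obj_map X 0 a a = {u}"
  then obtain e where e: "\<And>a. a \<in> S \<Longrightarrow> obj_map X 0 a a = {e a}"
    by metis
  define \<psi> where "\<psi> = (\<lambda>a b. \<lambda>u::unit\<in>unit_quiver S a b. e a)"
  have \<psi>: "\<psi> \<in> quiv_hom (unit_quiver S) (obj_map X 0)"
    unfolding \<psi>_def by (intro quiv_hom_restrictI) (auto simp: mem_unit_quiver e)
  have "quiv_comp (obj_map X 0) \<psi> (counit X) = quiv_id (obj_map X 0)"
    unfolding quiv_comp_eq_id_iff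
  proof (intro allI ballI)
    fix a b q assume q: "q \<in> obj_map X 0 a b"
    then have "b = a" "a \<in> S" using zero_eq mem_base by blast+
    with q e show "\<psi> a b (counit X a b q) = q" by (simp add: \<psi>_def mem_unit_quiver)
  qed
  moreover have "quiv_comp (unit_quiver S) (counit X) \<psi> = quiv_id (unit_quiver S)"
    by (simp add: quiv_comp_eq_id_iff)
  ultimately show "strongly_unital S X"
    unfolding strongly_unital_def quiv_iso_def using \<psi> counit_in_hom by blast
qed

text \<open>Evaluates the mate once and for all: \<open>adj_unit\<close> tags both pieces with their
  end points, \<open>pull_mult\<close> replaces the middle index by its image, and
  \<open>adj_counit\<close> drops the outer tags.\<close>

lemma push_comult_apply:
  assumes f: "f \<in> S \<rightarrow> T" and q: "q \<in> obj_map X (m + n) a b" "comult X m n a b q = (c, y, z)"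
  shows "comult (push_colax f S T X) m n (f a) (f b) (a, b, q) = (f c, (a, c, y), (c, b, z))"
proof -
  show ?thesis
    using comult_mem[OF q] mem_base[OF q(1)] q f
    by (auto simp: push_colax_def quiv_comp_apply push_comult_def mem_push push_map_def adj_counit_def
      pull_mult_def tensor_map_def mem_tensor adj_unit_def pull_def Pi_iff)
qed

text \<open>The locale \<open>monoidal_natural_transformation\<close> demands that its source be
  colax monoidal, so this is required before any morphism of templicial sets can be exhibited. Each
  axiom is that of \<open>X\<close> with tags carried along.\<close>

lemma colax_monoidal_push:
  assumes f: "f \<in> S \<rightarrow> T"
  shows "colax_monoidal T (push_colax f S T X)"
proof -
  let ?P = "push_colax f S T X"
  have ob: "obj_map ?P n = push f S (obj_map X n)" for n
    by (simp add: push_colax_def)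
  have arr: "arr_map ?P m n h (f a) (f b) (a, b, q) = (a, b, arr_map X m n h a b q)"
    if "q \<in> obj_map X m a b" for m n h a b q
    using that mem_base[OF that] by (simp add: push_colax_def push_map_def mem_push)
  have split: "\<exists>c y z. comult X m n a b q = (c, y, z) \<and> c \<in> S \<and> y \<in> obj_map X m a c \<and> z \<in> obj_map X n c b \<and>
      comult ?P m n (f a) (f b) (a, b, q) = (f c, (a, c, y), (c, b, z))"
    if q: "q \<in> obj_map X (m + n) a b" for m n a b q
  proof -
    obtain c y z where "comult X m n a b q = (c, y, z)"
      using prod_cases3 by blast
    with comult_mem[OF q this] push_comult_apply[OF f q this] show ?thesis by simp
  qed
  show ?thesis
  proof (rule colax_monoidalI, goal_cases)
    case (1 n)
    then show ?case using f by (auto simp: ob quiver_on_def push_def)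
  next
    case (2 m n h)
    then show ?case
      by (auto simp: push_colax_def push_map_def quiv_hom_def mem_push arr_in)
  next
    case (3 n a b x)
    then show ?case
      by (auto simp: ob push_def arr arr_id)
  next
    case (4 l m n h g a b x)
    then show ?case
      by (auto simp: ob push_def arr arr_comp arr_in)
  next
    case (5 m n)
    have "comult ?P m n x y q \<in> tensor T (obj_map ?P m) (obj_map ?P n) x y"
      if "q \<in> obj_map ?P (m + n) x y" for x y q
    proof -
      obtain a b t where q: "q = (a, b, t)" "x = f a" "y = f b" "t \<in> obj_map X (m + n) a b" "a \<in> S" "b \<in> S"
        using \<open>q \<in> obj_map ?P (m + n) x y\<close> by (auto simp: ob push_def)
      with split[OF q(4)] f show ?thesis
        by (auto simp: ob mem_push mem_tensor)
    qed
    moreover have "comult ?P m n x y q = undefined" if "q \<notin> obj_map ?P (m + n) x y" for x y q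
      using that by (simp add: push_colax_def quiv_comp_apply)
    ultimately show ?case by (auto simp: quiv_hom_def PiE_iff extensional_def)
  next
    case (6 a b x)
    then show ?case using zero_eq by (auto simp: ob push_def)
  next
    case (7 m m' n n' h g x y c q u v)
    obtain a b r where q: "q = (a, b, r)" "x = f a" "y = f b" "r \<in> obj_map X (m' + n') a b"
      using 7(3) by (auto simp: ob push_def)
    have h: "Delta_f_add m m' n h g \<in> Hom Delta_f (m + n) (m' + n')"
      using 7 by (simp add: Delta_f_add_in_Hom)
    obtain c' y' z' where s: "comult X m' n' a b r = (c', y', z')"
      using prod_cases3 by blast
    show ?case
      using 7(4) q s comult_mem[OF q(4) s] comult_arr[OF 7(1,2) q(4) s] arr_in[OF h q(4)]
      by (auto simp: push_comult_apply[OF f] arr)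
  next
    case (8 l m n x y c d q u r p s)
    obtain a b t where q: "q = (a, b, t)" "x = f a" "y = f b" "t \<in> obj_map X (l + m + n) a b"
      using 8(1) by (auto simp: ob push_def)
    obtain d' u' r' where 1: "comult X (l + m) n a b t = (d', u', r')" "d' \<in> S" "u' \<in> obj_map X (l + m) a d'" "r' \<in> obj_map X n d' b"
      using split[OF q(4)] by auto
    obtain c' q' p' where 2: "comult X l m a d' u' = (c', q', p')"
      using prod_cases3 by blast
    obtain w where w: "comult X l (m + n) a b t = (c', q', w)" "comult X m n c' b w = (d', p', r')"
      using comult_comult[OF q(4) 1(1) 2] by auto
    have t: "t \<in> obj_map X (l + (m + n)) a b" using q(4) by (simp add: add.assoc)
    have "w \<in> obj_map X (m + n) c' b" using comult_mem[OF t w(1)] by simp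
    then show ?case
      using 8 q 1 2 w t
      by (auto simp: push_comult_apply[OF f])
  next
    case (9 n x y c q u v)
    then obtain a b t where q: "q = (a, b, t)" "x = f a" "y = f b" "t \<in> obj_map X (0 + n) a b"
      by (auto simp: ob push_def)
    then show ?case using 9 split[OF q(4)] comult_0_left[of t n a b] by auto
  next
    case (10 n x y c q u v)
    then obtain a b t where q: "q = (a, b, t)" "x = f a" "y = f b" "t \<in> obj_map X (n + 0) a b"
      by (auto simp: ob push_def)
    then show ?case using 10 split[OF q(4)] comult_0_right[of t n a b] by auto
  qed
qed

end

section \<open>Simplicial sets from cutting simplices\<close>

definition interval_map :: "nat \<Rightarrow> nat \<Rightarrow> nat \<Rightarrow> nat" where
  "interval_map i j = (\<lambda>k\<in>{0..j - i}. i + k)"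

text \<open>\<open>seg h k l\<close> is the map \<open>[l - k] \<rightarrow> [h l - h k]\<close> obtained by restricting \<open>h\<close> to \<open>{k..l}\<close>.\<close>

definition seg :: "(nat \<Rightarrow> nat) \<Rightarrow> nat \<Rightarrow> nat \<Rightarrow> nat \<Rightarrow> nat" where
  "seg h k l = (\<lambda>i\<in>{0..l - k}. h (k + i) - h k)"

lemma mem_Delta:
  "h \<in> Hom Delta m n \<longleftrightarrow> (\<forall>i\<le>m. h i \<le> n) \<and> (\<forall>i j. i \<le> j \<and> j \<le> m \<longrightarrow> h i \<le> h j) \<and> h \<in> extensional {0..m}"
  by (auto simp: Delta_def mono_on_def PiE_iff)

lemma mem_Delta_f: "h \<in> Hom Delta_f m n \<longleftrightarrow> h \<in> Hom Delta m n \<and> h 0 = 0 \<and> h m = n"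
  by (simp add: Delta_f_def)

lemma DeltaD:
  assumes "h \<in> Hom Delta m n"
  shows "i \<le> m \<Longrightarrow> h i \<le> n" "\<lbrakk>i \<le> j; j \<le> m\<rbrakk> \<Longrightarrow> h i \<le> h j"
  using assms by (auto simp: mem_Delta)

lemma Delta_eqI:
  assumes "h \<in> extensional {0..m}" "g \<in> extensional {0..m}" "\<And>i. i \<le> m \<Longrightarrow> h i = g i"
  shows "h = g"
  using assms by (intro extensionalityI[of _ "{0..m}"]) auto

lemma id_in_Delta: "(\<lambda>i\<in>{0..n}. i) \<in> Hom Delta n n"
  by (auto simp: mem_Delta)

lemma id_in_Delta_f: "(\<lambda>i\<in>{0..n}. i) \<in> Hom Delta_f n n"
  by (auto simp: mem_Delta mem_Delta_f)

lemma compose_in_Delta: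
  "\<lbrakk>h \<in> Hom Delta l m; g \<in> Hom Delta m n\<rbrakk> \<Longrightarrow> compose {0..l} g h \<in> Hom Delta l n"
  by (auto simp: mem_Delta compose_def)

lemma interval_map_in_Delta: "\<lbrakk>i \<le> j; j \<le> n\<rbrakk> \<Longrightarrow> interval_map i j \<in> Hom Delta (j - i) n"
  by (auto simp: mem_Delta interval_map_def)

lemma interval_map_0: "interval_map 0 n = (\<lambda>i\<in>{0..n}. i)"
  by (simp add: interval_map_def)

lemma compose_interval_map:
  "\<lbrakk>k \<le> l; l \<le> j - i\<rbrakk> \<Longrightarrow> compose {0..l - k} (interval_map i j) (interval_map k l) = interval_map (i + k) (i + l)"
  by (rule Delta_eqI[of _ "l - k"]) (auto simp: interval_map_def compose_def)

lemma seg_in_Delta_f: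
  assumes "h \<in> Hom Delta m n" "k \<le> l" "l \<le> m"
  shows "seg h k l \<in> Hom Delta_f (l - k) (h l - h k)"
  using DeltaD[OF assms(1)] assms(2,3) by (auto simp: mem_Delta_f mem_Delta seg_def intro!: diff_le_mono)

lemma seg_all: "h \<in> Hom Delta_f m n \<Longrightarrow> seg h 0 m = h"
  by (rule Delta_eqI[of _ m]) (auto simp: mem_Delta_f mem_Delta seg_def)

lemma seg_interval_map: "\<lbrakk>k \<le> l; l \<le> j - i\<rbrakk> \<Longrightarrow> seg (interval_map i j) k l = (\<lambda>i\<in>{0..l - k}. i)"
  by (rule Delta_eqI[of _ "l - k"]) (auto simp: interval_map_def seg_def)

lemma seg_seg:
  assumes "h \<in> Hom Delta m n" "i \<le> j" "j \<le> m" "k \<le> l" "l \<le> j - i"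
  shows "seg (seg h i j) k l = seg h (i + k) (i + l)"
proof (rule Delta_eqI[of _ "l - k"])
  fix r assume "r \<le> l - k"
  moreover from this have "h i \<le> h (i + k)" using assms by (intro DeltaD(2)[OF assms(1)]) auto
  ultimately show "seg (seg h i j) k l r = seg h (i + k) (i + l) r"
    using assms by (auto simp: seg_def add.assoc)
qed (auto simp: seg_def)

lemma seg_compose:
  assumes h: "h \<in> Hom Delta l m" and g: "g \<in> Hom Delta m n" and "a \<le> b" "b \<le> l"
  shows "seg (compose {0..l} g h) a b = compose {0..b - a} (seg g (h a) (h b)) (seg h a b)"
proof (rule Delta_eqI[of _ "b - a"])
  fix r assume r: "r \<le> b - a"
  have "h a \<le> h (a + r)" "h (a + r) \<le> h b" using assms r by (auto intro!: DeltaD(2)[OF h])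
  then show "seg (compose {0..l} g h) a b r = compose {0..b - a} (seg g (h a) (h b)) (seg h a b) r"
    using assms r by (auto simp: seg_def compose_def)
qed (auto simp: seg_def)

text \<open>Both sides are \<open>h\<close> on \<open>{k..l}\<close>; the left side passes through
  the interval that \<open>h\<close> spans there. For \<open>k = 0\<close> and \<open>l = m\<close>
  this is the factorisation of \<open>h\<close> into a map of \<open>Delta_f\<close> and an interval
  inclusion.\<close>

lemma compose_interval_map_seg:
  assumes h: "h \<in> Hom Delta m n" and "k \<le> l" "l \<le> m"
  shows "compose {0..l - k} (interval_map (h k) (h l)) (seg h k l) = compose {0..l - k} h (interval_map k l)"
proof (rule Delta_eqI[of _ "l - k"])
  fix r assume r: "r \<le> l - k"
  have "h k \<le> h (k + r)" "h (k + r) \<le> h l" using assms r by (auto intro!: DeltaD(2)[OF h])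
  then show "compose {0..l - k} (interval_map (h k) (h l)) (seg h k l) r = compose {0..l - k} h (interval_map k l) r"
    using r by (auto simp: seg_def compose_def interval_map_def)
qed auto

text \<open>Makes the naturality of the comultiplication, which is stated for sums, applicable to an
  arbitrary map of \<open>Delta_f\<close> and an arbitrary cutting vertex \<open>k\<close>.\<close>

lemma Delta_f_add_seg:
  assumes h: "h \<in> Hom Delta_f m n" and "k \<le> m"
  shows "Delta_f_add k (h k) (m - k) (seg h 0 k) (seg h k m) = h"
proof (rule Delta_eqI[of _ m])
  have D: "h \<in> Hom Delta m n" "h 0 = 0" using h by (auto simp: mem_Delta_f)
  show "h \<in> extensional {0..m}" using D by (auto simp: mem_Delta)
  show "Delta_f_add k (h k) (m - k) (seg h 0 k) (seg h k m) \<in> extensional {0..m}"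
    using assms by (auto simp: Delta_f_add_def)
  fix i assume "i \<le> m"
  moreover have "h k \<le> h i" if "k \<le> i" using that \<open>i \<le> m\<close> by (intro DeltaD(2)[OF D(1)]) auto
  ultimately show "Delta_f_add k (h k) (m - k) (seg h 0 k) (seg h k m) i = h i"
    using assms D by (auto simp: Delta_f_add_def seg_def)
qed

lemma seg_Delta_f_add:
  assumes "f \<in> Hom Delta_f m m'" "g \<in> Hom Delta_f n n'"
  shows "seg (Delta_f_add m m' n f g) 0 m = f" "seg (Delta_f_add m m' n f g) m (m + n) = g"
    "Delta_f_add m m' n f g 0 = 0" "Delta_f_add m m' n f g m = m'" "Delta_f_add m m' n f g (m + n) = m' + n'"
  using assms
  by (auto simp: mem_Delta_f mem_Delta Delta_f_add_def seg_def fun_eq_iff extensional_def)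

text \<open>The element type is arbitrary and the action need not be extensional: the simplices
  built from a templicial set are triples, and they are coded in the universe only at the
  end.\<close>

locale simplicial_set =
  fixes K :: "nat \<Rightarrow> 'e set" and act :: "nat \<Rightarrow> nat \<Rightarrow> (nat \<Rightarrow> nat) \<Rightarrow> 'e \<Rightarrow> 'e"
  assumes act_in: "\<lbrakk>h \<in> Hom Delta m n; x \<in> K n\<rbrakk> \<Longrightarrow> act n m h x \<in> K m"
    and act_id: "x \<in> K n \<Longrightarrow> act n n (\<lambda>i\<in>{0..n}. i) x = x"
    and act_compose: "\<lbrakk>h \<in> Hom Delta l m; g \<in> Hom Delta m n; x \<in> K n\<rbrakk>
      \<Longrightarrow> act n l (compose {0..l} g h) x = act m l h (act n m g x)"
begin

text \<open>The restriction to the vertices \<open>i\<close> to \<open>j\<close>. For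
  \<open>i = j\<close> it is the \<open>i\<close>-th vertex, as a 0-simplex.\<close>

definition face :: "nat \<Rightarrow> nat \<Rightarrow> nat \<Rightarrow> 'e \<Rightarrow> 'e" where
  "face n i j x = act n (j - i) (interval_map i j) x"

lemma face_in: "\<lbrakk>i \<le> j; j \<le> n; x \<in> K n\<rbrakk> \<Longrightarrow> face n i j x \<in> K (j - i)"
  by (simp add: face_def act_in interval_map_in_Delta)

lemma face_all: "x \<in> K n \<Longrightarrow> face n 0 n x = x"
  by (simp add: face_def interval_map_0 act_id)

lemma face_face:
  assumes "i \<le> j" "j \<le> n" "k \<le> l" "l \<le> j - i" "x \<in> K n" "p = j - i"
  shows "face p k l (face n i j x) = face n (i + k) (i + l) x"
  using assms
  by (simp add: face_def act_compose[symmetric] interval_map_in_Delta compose_interval_map)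

lemma face_act:
  assumes "h \<in> Hom Delta m n" "k \<le> l" "l \<le> m" "x \<in> K n"
  shows "face m k l (act n m h x) = act (h l - h k) (l - k) (seg h k l) (face n (h k) (h l) x)"
proof -
  have "h k \<le> h l" "h l \<le> n" using DeltaD[OF assms(1)] assms by auto
  then show ?thesis
    using assms seg_in_Delta_f[OF assms(1-3)]
    by (simp add: face_def act_compose[symmetric] interval_map_in_Delta compose_interval_map_seg mem_Delta_f)
qed

text \<open>The factorisation of \<open>h\<close> read contravariantly: restrict to the interval
  between the images of the end vertices, then apply an endpoint-preserving map. A map that respects
  both kinds of action is therefore simplicial.\<close>

lemma act_face:
  assumes "h \<in> Hom Delta m n" "x \<in> K n"
  shows "act n m h x = act (h m - h 0) m (seg h 0 m) (face n (h 0) (h m) x)"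
  using face_act[OF assms(1) _ _ assms(2), of 0 m] face_all[OF act_in[OF assms]] by simp

end

text \<open>Simplices that can be cut at each vertex into a left and a right part; inner faces and
  degeneracies are given by \<open>A\<close>.\<close>

locale segmented =
  fixes E :: "nat \<Rightarrow> 'e set" and A :: "nat \<Rightarrow> nat \<Rightarrow> (nat \<Rightarrow> nat) \<Rightarrow> 'e \<Rightarrow> 'e"
    and L R :: "nat \<Rightarrow> nat \<Rightarrow> 'e \<Rightarrow> 'e"
  assumes A_in: "\<lbrakk>h \<in> Hom Delta_f m n; e \<in> E n\<rbrakk> \<Longrightarrow> A n m h e \<in> E m"
    and A_id: "e \<in> E n \<Longrightarrow> A n n (\<lambda>i\<in>{0..n}. i) e = e"
    and A_compose: "\<lbrakk>h \<in> Hom Delta_f l m; g \<in> Hom Delta_f m n; e \<in> E n\<rbrakk>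
      \<Longrightarrow> A n l (compose {0..l} g h) e = A m l h (A n m g e)"
    and L_in: "e \<in> E (m + n) \<Longrightarrow> L m n e \<in> E m"
    and R_in: "e \<in> E (m + n) \<Longrightarrow> R m n e \<in> E n"
    and L_A: "\<lbrakk>f \<in> Hom Delta_f m m'; g \<in> Hom Delta_f n n'; e \<in> E (m' + n')\<rbrakk>
      \<Longrightarrow> L m n (A (m' + n') (m + n) (Delta_f_add m m' n f g) e) = A m' m f (L m' n' e)"
    and R_A: "\<lbrakk>f \<in> Hom Delta_f m m'; g \<in> Hom Delta_f n n'; e \<in> E (m' + n')\<rbrakk>
      \<Longrightarrow> R m n (A (m' + n') (m + n) (Delta_f_add m m' n f g) e) = A n' n g (R m' n' e)"
    and L_L: "e \<in> E (l + m + n) \<Longrightarrow> L l m (L (l + m) n e) = L l (m + n) e"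
    and R_L: "e \<in> E (l + m + n) \<Longrightarrow> R l m (L (l + m) n e) = L m n (R l (m + n) e)"
    and R_R: "e \<in> E (l + m + n) \<Longrightarrow> R m n (R l (m + n) e) = R (l + m) n e"
    and L_0: "e \<in> E n \<Longrightarrow> L n 0 e = e"
    and R_0: "e \<in> E n \<Longrightarrow> R 0 n e = e"
begin

text \<open>What lies after vertex \<open>j\<close> is dropped first, then what lies before vertex
  \<open>i\<close>. By \<open>R_L\<close> the opposite order gives the same piece.\<close>

definition cut :: "nat \<Rightarrow> nat \<Rightarrow> nat \<Rightarrow> 'e \<Rightarrow> 'e" where
  "cut n i j e = R i (j - i) (L j (n - j) e)"

lemma cut_in: "\<lbrakk>i \<le> j; j \<le> n; e \<in> E n\<rbrakk> \<Longrightarrow> cut n i j e \<in> E (j - i)"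
  unfolding cut_def by (intro R_in) (simp add: L_in)

lemma cut_all: "e \<in> E n \<Longrightarrow> cut n 0 n e = e"
  by (simp add: cut_def L_0 R_0)

text \<open>The vertices in play divide \<open>n\<close> as \<open>i + k + r + s + t\<close>, and
  \<open>r\<close> is the length of the final piece. \<open>R_L\<close> moves the inner right-hand
  cut past the outer left-hand one, after which \<open>L_L\<close> and \<open>R_R\<close> merge cuts
  on the same side.\<close>

lemma cut_cut:
  assumes "i \<le> j" "j \<le> n" "k \<le> l" "l \<le> j - i" "e \<in> E n"
  shows "cut (j - i) k l (cut n i j e) = cut n (i + k) (i + l) e"
proof -
  define r s t where "r = l - k" "s = j - i - l" "t = n - j"
  have j: "j = i + (k + r) + s" and l: "l = k + r" and n: "n = i + (k + r) + s + t"
    using assms by (auto simp: r_s_t_def)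
  have e: "e \<in> E (i + (k + r) + s + t)" using assms(5) n by simp
  have e1: "L (i + (k + r) + s) t e \<in> E (i + (k + r) + s)" using e by (rule L_in)
  have e2: "L (i + (k + r)) (s + t) e \<in> E (i + k + r)"
    using L_in[of e "i + (k + r)" "s + t"] e by (simp add: add.assoc)
  have "cut (j - i) k l (cut n i j e)
    = R k r (L (k + r) s (R i (k + r + s) (L (i + (k + r) + s) t e)))"
    by (simp add: cut_def j l n add.assoc)
  also have "\<dots> = R k r (R i (k + r) (L (i + (k + r)) s (L (i + (k + r) + s) t e)))"
    by (simp only: R_L[OF e1])
  also have "\<dots> = R k r (R i (k + r) (L (i + (k + r)) (s + t) e))"
    by (simp only: L_L[OF e])
  also have "\<dots> = R (i + k) r (L (i + (k + r)) (s + t) e)"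
    by (rule R_R[OF e2])
  also have "\<dots> = cut n (i + k) (i + l) e"
    by (simp add: cut_def j l n add.assoc)
  finally show ?thesis .
qed

text \<open>The exchange of cuts with endpoint-preserving maps. Since \<open>L_A\<close> and
  \<open>R_A\<close> apply to sums only, \<open>h\<close> is split at \<open>l\<close> and the left
  part taken; then \<open>seg h 0 l\<close> is split at \<open>k\<close> and the right part
  taken.\<close>

lemma cut_A:
  assumes h: "h \<in> Hom Delta_f m n" and kl: "k \<le> l" "l \<le> m" and e: "e \<in> E n"
  shows "cut m k l (A n m h e) = A (h l - h k) (l - k) (seg h k l) (cut n (h k) (h l) e)"
proof -
  have D: "h \<in> Hom Delta m n" "h 0 = 0" "h m = n" using h by (auto simp: mem_Delta_f)
  have le: "h k \<le> h l" "h l \<le> n" using DeltaD[OF D(1)] kl by auto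
  let ?h = "seg h 0 l"
  have h': "?h \<in> Hom Delta_f l (h l)" using seg_in_Delta_f[OF D(1), of 0 l] D kl by simp
  have hl: "seg h l m \<in> Hom Delta_f (m - l) (n - h l)" using seg_in_Delta_f[OF D(1), of l m] D kl by simp
  have "L l (m - l) (A n m h e) = A (h l) l ?h (L (h l) (n - h l) e)"
    using L_A[OF h' hl, of e] Delta_f_add_seg[OF h kl(2)] e kl le by simp
  moreover have "R k (l - k) (A (h l) l ?h e') = A (h l - h k) (l - k) (seg h k l) (R (h k) (h l - h k) e')"
    if e': "e' \<in> E (h l)" for e'
  proof -
    have D': "?h \<in> Hom Delta l (h l)" using h' by (auto simp: mem_Delta_f)
    have v: "?h k = h k" "?h l = h l" "?h 0 = 0" using kl D by (auto simp: seg_def)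
    have h1: "seg ?h 0 k \<in> Hom Delta_f k (h k)"
      using seg_in_Delta_f[OF D', of 0 k] v kl by simp
    have h2: "seg h k l \<in> Hom Delta_f (l - k) (h l - h k)"
      using seg_in_Delta_f[OF D(1) kl] .
    have "seg ?h k l = seg h k l"
      using seg_seg[OF D(1), of 0 l k l] kl by simp
    then have "Delta_f_add k (h k) (l - k) (seg ?h 0 k) (seg h k l) = ?h"
      using Delta_f_add_seg[OF h' kl(1)] v by simp
    then show ?thesis
      using R_A[OF h1 h2, of e'] e' kl le by simp
  qed
  moreover have "L (h l) (n - h l) e \<in> E (h l)"
    using e le by (intro L_in) simp
  ultimately show ?thesis by (simp add: cut_def)
qed

text \<open>By \<open>act_face\<close>, no other action of \<open>Delta\<close> can restrict to
  \<open>A\<close> on \<open>Delta_f\<close> and to \<open>cut\<close> on interval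
  inclusions.\<close>

definition segmented_act :: "nat \<Rightarrow> nat \<Rightarrow> (nat \<Rightarrow> nat) \<Rightarrow> 'e \<Rightarrow> 'e" where
  "segmented_act n m h e = A (h m - h 0) m (seg h 0 m) (cut n (h 0) (h m) e)"

lemma segmented_act_Delta_f: "\<lbrakk>h \<in> Hom Delta_f m n; e \<in> E n\<rbrakk> \<Longrightarrow> segmented_act n m h e = A n m h e"
  by (frule seg_all) (simp add: segmented_act_def cut_all mem_Delta_f)

lemma segmented_act_interval_map:
  assumes "i \<le> j" "j \<le> n" "e \<in> E n"
  shows "segmented_act n (j - i) (interval_map i j) e = cut n i j e"
proof -
  have "interval_map i j (j - i) = j" "interval_map i j 0 = i"
    using assms by (auto simp: interval_map_def)
  then show ?thesis
    using assms by (simp add: segmented_act_def seg_interval_map A_id cut_in)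
qed

text \<open>In the composite action a cut along \<open>h\<close> comes after an \<open>A\<close>
  along \<open>g\<close>. \<open>cut_A\<close> exchanges them, \<open>cut_cut\<close> merges the two
  cuts, \<open>A_compose\<close> merges the two \<open>A\<close>, and \<open>seg_compose\<close>
  recognises the result as the restriction of the composite.\<close>

lemma simplicial_set_segmented: "simplicial_set E segmented_act"
proof
  fix h m n x assume h: "h \<in> Hom Delta m n" and x: "x \<in> E n"
  have "seg h 0 m \<in> Hom Delta_f m (h m - h 0)"
    using seg_in_Delta_f[OF h, of 0 m] by simp
  moreover have "cut n (h 0) (h m) x \<in> E (h m - h 0)"
    using x DeltaD[OF h] by (intro cut_in) auto
  ultimately show "segmented_act n m h x \<in> E m"
    unfolding segmented_act_def by (rule A_in)
next
  fix x n assume "x \<in> E n"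
  then show "segmented_act n n (\<lambda>i\<in>{0..n}. i) x = x"
    by (simp add: segmented_act_Delta_f id_in_Delta_f A_id)
next
  fix h l m g n x assume h: "h \<in> Hom Delta l m" and g: "g \<in> Hom Delta m n" and x: "x \<in> E n"
  have le: "h 0 \<le> h l" "h l \<le> m" "g 0 \<le> g (h 0)" "g (h 0) \<le> g (h l)" "g (h l) \<le> g m" "g m \<le> n"
    using DeltaD[OF h] DeltaD[OF g] by auto
  let ?g = "seg g 0 m" and ?c = "cut n (g 0) (g m) x"
  have g': "?g \<in> Hom Delta_f m (g m - g 0)"
    using seg_in_Delta_f[OF g, of 0 m] by simp
  have c: "?c \<in> E (g m - g 0)"
    using x le by (intro cut_in) auto
  \<comment> \<open>\<open>seg\<close> shifts values down by \<open>g 0\<close>; by monotonicity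
    these subtractions of naturals are exact, so \<open>cut_cut\<close> can add \<open>g 0\<close>
    back.\<close>
  have v: "?g (h 0) = g (h 0) - g 0" "?g (h l) = g (h l) - g 0"
    using le by (auto simp: seg_def)
  have "cut m (h 0) (h l) (A (g m - g 0) m ?g ?c)
    = A (g (h l) - g (h 0)) (h l - h 0) (seg ?g (h 0) (h l)) (cut (g m - g 0) (?g (h 0)) (?g (h l)) ?c)"
    using cut_A[OF g' le(1,2) c] le by (simp add: v)
  also have "seg ?g (h 0) (h l) = seg g (h 0) (h l)"
    using seg_seg[OF g, of 0 m "h 0" "h l"] le by simp
  also have "cut (g m - g 0) (?g (h 0)) (?g (h l)) ?c = cut n (g (h 0)) (g (h l)) x"
    using cut_cut[of "g 0" "g m" n "g (h 0) - g 0" "g (h l) - g 0" x] le x by (simp add: v)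
  finally have "segmented_act m l h (segmented_act n m g x) = A (h l - h 0) l (seg h 0 l)
      (A (g (h l) - g (h 0)) (h l - h 0) (seg g (h 0) (h l)) (cut n (g (h 0)) (g (h l)) x))"
    by (simp add: segmented_act_def)
  also have "\<dots> = A (g (h l) - g (h 0)) l (compose {0..l} (seg g (h 0) (h l)) (seg h 0 l))
      (cut n (g (h 0)) (g (h l)) x)"
    using seg_in_Delta_f[OF h, of 0 l] seg_in_Delta_f[OF g, of "h 0" "h l"] le x
    by (intro A_compose[symmetric] cut_in) auto
  also have "\<dots> = segmented_act n l (compose {0..l} g h) x"
    using seg_compose[OF h g, of 0 l] by (simp add: segmented_act_def compose_eq)
  finally show "segmented_act n l (compose {0..l} g h) x = segmented_act m l h (segmented_act n m g x)"
    by simp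
qed

end

section \<open>The category of templicial sets\<close>

text \<open>The transpose of a monoidal transformation from \<open>f_!X\<close> to \<open>Y\<close>.
  Values of \<phi> outside the cells are unconstrained, and compatibility with counits has no clause
  because it holds automatically.\<close>

definition cell_map ::
  "('s, 'q) colax \<Rightarrow> ('t, 'p) colax \<Rightarrow> ('s \<Rightarrow> 't) \<Rightarrow> (nat \<Rightarrow> 's \<Rightarrow> 's \<Rightarrow> 'q \<Rightarrow> 'p) \<Rightarrow> bool" where
  "cell_map X Y f \<phi> \<longleftrightarrow>
    (\<forall>n a b q. q \<in> obj_map X n a b \<longrightarrow> \<phi> n a b q \<in> obj_map Y n (f a) (f b)) \<and>
    (\<forall>m n h a b q. h \<in> Hom Delta_f n m \<longrightarrow> q \<in> obj_map X m a b \<longrightarrow>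
      \<phi> n a b (arr_map X m n h a b q) = arr_map Y m n h (f a) (f b) (\<phi> m a b q)) \<and>
    (\<forall>m n a b c q y z. q \<in> obj_map X (m + n) a b \<longrightarrow> comult X m n a b q = (c, y, z) \<longrightarrow>
      comult Y m n (f a) (f b) (\<phi> (m + n) a b q) = (f c, \<phi> m a c y, \<phi> n c b z))"

lemma cell_mapD:
  assumes "cell_map X Y f \<phi>"
  shows "q \<in> obj_map X n a b \<Longrightarrow> \<phi> n a b q \<in> obj_map Y n (f a) (f b)"
    "\<lbrakk>h \<in> Hom Delta_f n m; q \<in> obj_map X m a b\<rbrakk>
      \<Longrightarrow> \<phi> n a b (arr_map X m n h a b q) = arr_map Y m n h (f a) (f b) (\<phi> m a b q)"
    "\<lbrakk>q \<in> obj_map X (m + n) a b; comult X m n a b q = (c, y, z)\<rbrakk>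
      \<Longrightarrow> comult Y m n (f a) (f b) (\<phi> (m + n) a b q) = (f c, \<phi> m a c y, \<phi> n c b z)"
  using assms unfolding cell_map_def by blast+

text \<open>The transpose back to \<open>f_!X\<close>. The restriction erases the arbitrary values
  of \<phi>, so equality of two results means agreement on cells.\<close>

definition push_cells ::
  "'s set \<Rightarrow> ('s, 'q) colax \<Rightarrow> ('s \<Rightarrow> 't) \<Rightarrow> (nat \<Rightarrow> 's \<Rightarrow> 's \<Rightarrow> 'q \<Rightarrow> 'p)
    \<Rightarrow> nat \<Rightarrow> ('t, 's \<times> 's \<times> 'q, 'p) quiver_map" where
  "push_cells S X f \<phi> = (\<lambda>n x y. \<lambda>(a, b, q)\<in>push f S (obj_map X n) x y. \<phi> n a b q)"

context colax_monoidal
begin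

lemma push_cells_apply: "q \<in> obj_map X n a b \<Longrightarrow> push_cells S X f \<phi> n (f a) (f b) (a, b, q) = \<phi> n a b q"
  using mem_base[of q n a b] by (simp add: push_cells_def mem_push)

lemma push_cells_eq_iff:
  "push_cells S X f \<phi> = push_cells S X f \<phi>' \<longleftrightarrow>
    (\<forall>n a b q. q \<in> obj_map X n a b \<longrightarrow> \<phi> n a b q = \<phi>' n a b q)"
proof
  assume "push_cells S X f \<phi> = push_cells S X f \<phi>'"
  then show "\<forall>n a b q. q \<in> obj_map X n a b \<longrightarrow> \<phi> n a b q = \<phi>' n a b q"
    by (metis push_cells_apply)
next
  assume "\<forall>n a b q. q \<in> obj_map X n a b \<longrightarrow> \<phi> n a b q = \<phi>' n a b q"
  then show "push_cells S X f \<phi> = push_cells S X f \<phi>'"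
    by (auto simp: push_cells_def fun_eq_iff restrict_def push_def)
qed

lemma push_mem_cases:
  assumes "r \<in> obj_map (push_colax f S T X) n x y"
  obtains a b q where "r = (a, b, q)" "x = f a" "y = f b" "q \<in> obj_map X n a b" "a \<in> S" "b \<in> S"
  using assms by (auto simp: push_colax_def push_def)

lemma push_memI: "q \<in> obj_map X n a b \<Longrightarrow> (a, b, q) \<in> obj_map (push_colax f S T X) n (f a) (f b)"
  using mem_base[of q n a b] by (simp add: push_colax_def push_def)

lemma push_arr:
  "q \<in> obj_map X m a b \<Longrightarrow> arr_map (push_colax f S T X) m n h (f a) (f b) (a, b, q) = (a, b, arr_map X m n h a b q)"
  using mem_base[of q m a b] by (simp add: push_colax_def push_map_def mem_push)

lemma monoidal_natural_transformation_push_cells: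
  assumes Y: "colax_monoidal T Y" and f: "f \<in> S \<rightarrow> T" and \<phi>: "cell_map X Y f \<phi>"
  shows "monoidal_natural_transformation T (push_colax f S T X) Y (push_cells S X f \<phi>)"
proof -
  let ?P = "push_colax f S T X" and ?a = "push_cells S X f \<phi>"
  interpret P: colax_monoidal T ?P by (rule colax_monoidal_push[OF f])
  interpret Y: colax_monoidal T Y by fact
  note D = cell_mapD[OF \<phi>]
  show ?thesis
  proof (intro monoidal_natural_transformation.intro monoidal_natural_transformation_axioms.intro
      P.colax_monoidal_axioms Y.colax_monoidal_axioms, goal_cases)
    case (1 n)
    then show ?case
      using D(1) by (auto simp: quiv_hom_def push_cells_def push_colax_def push_def)
  next
    case (2 h m n)
    have h: "h \<in> Hom Delta_f n m" using 2 by (simp add: op_cat_def)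
    have "?a n x y (arr_map ?P m n h x y r) = arr_map Y m n h x y (?a m x y r)"
      if "r \<in> obj_map ?P m x y" for x y r
      using that by (elim push_mem_cases) (simp add: push_arr push_cells_apply arr_in h D)
    then show ?case by (simp add: quiv_comp_eq_iff)
  next
    case (3 m n)
    have "tensor_map T (obj_map ?P m) (obj_map ?P n) (?a m) (?a n) x y (comult ?P m n x y r)
        = comult Y m n x y (?a (m + n) x y r)"
      if r: "r \<in> obj_map ?P (m + n) x y" for x y r
    proof -
      obtain a b q where q: "r = (a, b, q)" "x = f a" "y = f b" "q \<in> obj_map X (m + n) a b"
        using r by (rule push_mem_cases)
      obtain c u v where c: "comult X m n a b q = (c, u, v)"
        using prod_cases3 by blast
      note cm = comult_mem[OF q(4) c]
      show ?thesis
        using q c cm f D(3)[OF q(4) c]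
        by (auto simp: push_comult_apply[OF f q(4) c] tensor_map_def mem_tensor push_memI push_cells_apply)
    qed
    then show ?case by (simp add: quiv_comp_eq_iff)
  next
    \<comment> \<open>Compatibility with counits: both sides take values in
      \<open>unit\<close>.\<close>
    case 4
    then show ?case
      by (intro ext) simp
  qed
qed

text \<open>The family \<phi> is \<alpha> precomposed with the adjunction unit \<open>q\<close>
  \<mapsto> \<open>(a, b, q)\<close>. Every element of \<open>f_!X\<close> over
  \<open>(x, y)\<close> has this form for some \<open>a\<close>, \<open>b\<close> over
  \<open>x\<close>, \<open>y\<close>, so \<alpha> is recovered from \<phi>.\<close>

lemma cell_map_of_monoidal_natural_transformation:
  assumes "f \<in> S \<rightarrow> T" and "monoidal_natural_transformation T (push_colax f S T X) Y \<alpha>"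
  defines "\<phi> \<equiv> \<lambda>n a b q. \<alpha> n (f a) (f b) (a, b, q)"
  shows "cell_map X Y f \<phi>" "\<alpha> = push_cells S X f \<phi>"
proof -
  let ?P = "push_colax f S T X"
  interpret monoidal_natural_transformation T ?P Y \<alpha> by fact
  note f = assms(1)
  show "\<alpha> = push_cells S X f \<phi>"
  proof
    fix n
    have "push_cells S X f \<phi> n \<in> quiv_hom (obj_map ?P n) (obj_map Y n)"
      using quiv_homD[OF component_in_hom[of n]]
      by (auto simp: quiv_hom_def push_cells_def push_colax_def push_def \<phi>_def)
    then show "\<alpha> n = push_cells S X f \<phi> n"
      by (rule quiv_hom_eqI[OF component_in_hom])
        (auto elim!: push_mem_cases simp: push_cells_apply \<phi>_def)
  qed
  show "cell_map X Y f \<phi>"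
    unfolding cell_map_def
  proof (intro conjI allI impI)
    fix n a b q assume "q \<in> obj_map X n a b"
    then show "\<phi> n a b q \<in> obj_map Y n (f a) (f b)"
      using quiv_homD[OF component_in_hom push_memI] by (simp add: \<phi>_def)
  next
    fix m n h a b q assume "h \<in> Hom Delta_f n m" and q: "q \<in> obj_map X m a b"
    then have "h \<in> Hom (op_cat Delta_f) m n" by (simp add: op_cat_def)
    from component_natural[OF this, unfolded quiv_comp_eq_iff, rule_format, OF push_memI[OF q]] q
    show "\<phi> n a b (arr_map X m n h a b q) = arr_map Y m n h (f a) (f b) (\<phi> m a b q)"
      by (simp add: push_arr \<phi>_def)
  next
    fix m n a b c q y z assume q: "q \<in> obj_map X (m + n) a b" and c: "comult X m n a b q = (c, y, z)"
    from component_comult[of m n, unfolded quiv_comp_eq_iff, rule_format, OF push_memI[OF q]]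
    show "comult Y m n (f a) (f b) (\<phi> (m + n) a b q) = (f c, \<phi> m a c y, \<phi> n c b z)"
      using q c comult_mem[OF q c] funcset_mem[OF f comult_mem(1)[OF q c]]
      by (auto simp: push_comult_apply[OF f q c] tensor_map_def mem_tensor push_memI \<phi>_def)
  qed
qed

end

text \<open>\<open>compose S g f\<close> agrees with \<open>g (f a)\<close> only for
  \<open>a\<close> in \<open>S\<close>; that \<open>X\<close> is colax monoidal over
  \<open>S\<close> places the end points of cells and the middle points of cuts there.\<close>

lemma cell_map_comp:
  assumes \<phi>: "cell_map X Y f \<phi>" and \<psi>: "cell_map Y Z g \<psi>" and X: "colax_monoidal S X"
  shows "cell_map X Z (compose S g f) (\<lambda>n a b q. \<psi> n (f a) (f b) (\<phi> n a b q))"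
proof -
  interpret X: colax_monoidal S X by fact
  have c: "compose S g f a = g (f a)" if "a \<in> S" for a
    using that by (simp add: compose_def)
  note D = cell_mapD[OF \<phi>] cell_mapD[OF \<psi>]
  show ?thesis
    unfolding cell_map_def
  proof (intro conjI allI impI)
    fix n a b q assume q: "q \<in> obj_map X n a b"
    with X.mem_base[OF q] show "\<psi> n (f a) (f b) (\<phi> n a b q) \<in> obj_map Z n (compose S g f a) (compose S g f b)"
      by (simp add: c D)
  next
    fix m n h a b q assume h: "h \<in> Hom Delta_f n m" and q: "q \<in> obj_map X m a b"
    with X.mem_base[OF q] D(1)[OF q]
    show "\<psi> n (f a) (f b) (\<phi> n a b (arr_map X m n h a b q)) =
       arr_map Z m n h (compose S g f a) (compose S g f b) (\<psi> m (f a) (f b) (\<phi> m a b q))"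
      by (simp add: c D)
  next
    fix m n a b c' q y z assume q: "q \<in> obj_map X (m + n) a b" and s: "comult X m n a b q = (c', y, z)"
    with X.mem_base[OF q] X.comult_mem[OF q s] D(1)[OF q] D(3)[OF q s]
    show "comult Z m n (compose S g f a) (compose S g f b) (\<psi> (m + n) (f a) (f b) (\<phi> (m + n) a b q)) =
       (compose S g f c', \<psi> m (f a) (f c') (\<phi> m a c' y), \<psi> n (f c') (f b) (\<phi> n c' b z))"
      by (simp add: c D)
  qed
qed

section \<open>Morphisms, composition and isomorphisms of templicial sets in terms of cells\<close>

lemma Ob_TSet: "(X, S) \<in> Ob TSet \<longleftrightarrow> colax_monoidal S X \<and> strongly_unital S X"
  by (simp add: TSet_def)

lemma Hom_TSet_iff:
  assumes "colax_monoidal S X" "colax_monoidal T Y"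
  shows "(\<alpha>, f) \<in> Hom TSet (X, S) (Y, T) \<longleftrightarrow>
    f \<in> S \<rightarrow>\<^sub>E T \<and> (\<exists>\<phi>. cell_map X Y f \<phi> \<and> \<alpha> = push_cells S X f \<phi>)"
proof -
  interpret X: colax_monoidal S X by fact
  have "monoidal_natural_transformation T (push_colax f S T X) Y \<alpha> \<longleftrightarrow>
    (\<exists>\<phi>. cell_map X Y f \<phi> \<and> \<alpha> = push_cells S X f \<phi>)" if "f \<in> S \<rightarrow>\<^sub>E T"
  proof -
    have f: "f \<in> S \<rightarrow> T" using that by auto
    show ?thesis
      using X.monoidal_natural_transformation_push_cells[OF assms(2) f]
        X.cell_map_of_monoidal_natural_transformation[OF f] by blast
  qed
  then show ?thesis by (auto simp: TSet_def)
qed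

text \<open>\<open>push_push\<close> tags \<open>(a, b, q)\<close> with \<open>f a\<close> and
  \<open>f b\<close>, which are exactly the end points at which \<psi> has to be applied to the
  image of \<open>q\<close> under \<phi>. So composition of morphisms is composition of cell
  maps.\<close>

lemma Comp_TSet:
  fixes X Y Z :: "('u, 'u) colax"
  assumes "colax_monoidal S X" "f \<in> S \<rightarrow> T" "cell_map X Y f \<phi>"
    and "colax_monoidal T Y"
  shows "Comp TSet (X, S) (Y, T) (Z, U) (push_cells T Y g \<psi>, g) (push_cells S X f \<phi>, f)
    = (push_cells S X (compose S g f) (\<lambda>n a b q. \<psi> n (f a) (f b) (\<phi> n a b q)), compose S g f)"
proof -
  interpret X: colax_monoidal S X by fact
  interpret Y: colax_monoidal T Y by fact
  have *: "(f a, f b, a, b, q) \<in> push g T (push f S (obj_map X n)) (g (f a)) (g (f b))"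
    "f a \<in> T" "f b \<in> T"
    if "a \<in> S" "b \<in> S" "q \<in> obj_map X n a b" for a b q n
    using that assms(2) by (auto simp: mem_push)
  have "quiv_comp (push (compose S g f) S (obj_map X n)) (push_cells T Y g \<psi> n)
          (quiv_comp (push (compose S g f) S (obj_map X n))
            (push_map g T (push f S (obj_map X n)) (push_cells S X f \<phi> n))
            (push_push g f S (obj_map X n))) x y r
     = push_cells S X (compose S g f) (\<lambda>n a b q. \<psi> n (f a) (f b) (\<phi> n a b q)) n x y r" for n x y r
  proof (cases "r \<in> push (compose S g f) S (obj_map X n) x y")
    case True
    then obtain a b q where r: "r = (a, b, q)" "x = g (f a)" "y = g (f b)" "a \<in> S" "b \<in> S" "q \<in> obj_map X n a b"
      by (auto simp: push_def compose_def)
    then show ?thesis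
      using True *[OF r(4-6)] cell_mapD(1)[OF assms(3) r(6)]
      by (simp add: quiv_comp_apply push_push_def push_map_def X.push_cells_apply Y.push_cells_apply)
        (simp add: push_cells_def)
  next
    case False
    then show ?thesis by (simp add: quiv_comp_apply push_cells_def)
  qed
  then show ?thesis by (simp add: TSet_def fun_eq_iff)
qed

lemma Id_TSet: "Id TSet (X, S) = (push_cells S X (\<lambda>a\<in>S. a) (\<lambda>n a b q. q), \<lambda>a\<in>S. a)"
  by (simp add: TSet_def push_cells_def)

lemma cell_map_id: "colax_monoidal S X \<Longrightarrow> cell_map X X (\<lambda>a\<in>S. a) (\<lambda>n a b q. q)"
  unfolding cell_map_def
  by (simp add: colax_monoidal.mem_base) (metis colax_monoidal.comult_mem(1))

text \<open>Every morphism has the normal form given by \<open>push_cells\<close> and its base map,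
  so the laws reduce to laws for functions, compared on cells only.\<close>

lemma category_TSet: "category (TSet :: ('u templicial, 'u templicial_map) cat)"
proof -
  let ?C = "TSet :: ('u templicial, 'u templicial_map) cat"
  have HomE: "\<exists>f \<phi>. \<alpha> = (push_cells (snd A) (fst A) f \<phi>, f) \<and> cell_map (fst A) (fst B) f \<phi>
      \<and> f \<in> snd A \<rightarrow>\<^sub>E snd B"
    if "A \<in> Ob ?C" "B \<in> Ob ?C" "\<alpha> \<in> Hom ?C A B" for A B \<alpha>
    using that by (cases A; cases B; cases \<alpha>) (auto simp: Ob_TSet Hom_TSet_iff)
  have cm: "colax_monoidal (snd A) (fst A)" if "A \<in> Ob ?C" for A
    using that by (cases A) (auto simp: Ob_TSet)
  have Comp: "Comp ?C A B D (push_cells (snd B) (fst B) g \<psi>, g) (push_cells (snd A) (fst A) f \<phi>, f)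
    = (push_cells (snd A) (fst A) (compose (snd A) g f) (\<lambda>n a b q. \<psi> n (f a) (f b) (\<phi> n a b q)), compose (snd A) g f)"
    if "A \<in> Ob ?C" "B \<in> Ob ?C" "f \<in> snd A \<rightarrow>\<^sub>E snd B" "cell_map (fst A) (fst B) f \<phi>"
    for A B D f \<phi> g \<psi>
  proof -
    have "f \<in> snd A \<rightarrow> snd B" using that(3) by auto
    from Comp_TSet[OF cm[OF that(1)] this that(4) cm[OF that(2)], of "fst D" "snd D" g \<psi>]
    show ?thesis by simp
  qed
  have HomI: "(push_cells (snd A) (fst A) f \<phi>, f) \<in> Hom ?C A B"
    if "A \<in> Ob ?C" "B \<in> Ob ?C" "f \<in> snd A \<rightarrow>\<^sub>E snd B" "cell_map (fst A) (fst B) f \<phi>" for A B f \<phi>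
    using that by (cases A; cases B) (auto simp: Ob_TSet Hom_TSet_iff)
  have Id: "Id ?C A = (push_cells (snd A) (fst A) (\<lambda>a\<in>snd A. a) (\<lambda>n a b q. q), \<lambda>a\<in>snd A. a)" for A
    by (cases A) (simp add: Id_TSet)
  have eq: "(push_cells (snd A) (fst A) f \<phi>, f) = (push_cells (snd A) (fst A) g \<psi>, g)"
    if "A \<in> Ob ?C" "f = g" "\<And>n a b q. q \<in> obj_map (fst A) n a b \<Longrightarrow> \<phi> n a b q = \<psi> n a b q" for A f \<phi> g \<psi>
  proof -
    have "push_cells (snd A) (fst A) g \<phi> = push_cells (snd A) (fst A) g \<psi>"
      using that(3) by (intro colax_monoidal.push_cells_eq_iff[OF cm[OF that(1)], THEN iffD2]) auto
    with that(2) show ?thesis by simp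
  qed
  have compE: "compose A g f \<in> A \<rightarrow>\<^sub>E D" if "f \<in> A \<rightarrow>\<^sub>E B" "g \<in> B \<rightarrow>\<^sub>E D" for A B D and g f :: "'u \<Rightarrow> 'u"
    using that by (auto simp: compose_def)
  have id_E: "(\<lambda>a\<in>A. a) \<in> A \<rightarrow>\<^sub>E A" for A :: "'u set" by auto
  note cid = cell_map_id[OF cm]
  show ?thesis
  proof (unfold_locales, goal_cases)
    case (1 a)
    then show ?case unfolding Id by (intro HomI id_E cid)
  next
    case (2 a b c f g)
    obtain k \<phi> where f: "f = (push_cells (snd a) (fst a) k \<phi>, k)" "cell_map (fst a) (fst b) k \<phi>"
      "k \<in> snd a \<rightarrow>\<^sub>E snd b"
      using HomE[OF 2(1,2,4)] by blast
    obtain l \<psi> where g: "g = (push_cells (snd b) (fst b) l \<psi>, l)" "cell_map (fst b) (fst c) l \<psi>"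
      "l \<in> snd b \<rightarrow>\<^sub>E snd c"
      using HomE[OF 2(2,3,5)] by blast
    show ?case
      unfolding f(1) g(1) Comp[OF 2(1,2) f(3,2)]
      by (rule HomI[OF 2(1,3) compE[OF f(3) g(3)] cell_map_comp[OF f(2) g(2) cm[OF 2(1)]]])
  next
    case (3 a b f)
    obtain k \<phi> where f: "f = (push_cells (snd a) (fst a) k \<phi>, k)" "cell_map (fst a) (fst b) k \<phi>"
      "k \<in> snd a \<rightarrow>\<^sub>E snd b"
      using HomE[OF 3] by blast
    show ?case
      unfolding f(1) Id Comp[OF 3(1,1) id_E cid[OF 3(1)]]
    proof (rule eq[OF 3(1)])
      show k: "compose (snd a) k (\<lambda>a\<in>snd a. a) = k"
        using f(3) by (auto simp: compose_def PiE_iff extensional_def)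
    qed (auto dest: colax_monoidal.mem_base[OF cm[OF 3(1)]])
  next
    case (4 a b f)
    obtain k \<phi> where f: "f = (push_cells (snd a) (fst a) k \<phi>, k)" "cell_map (fst a) (fst b) k \<phi>"
      "k \<in> snd a \<rightarrow>\<^sub>E snd b"
      using HomE[OF 4] by blast
    show ?case
      unfolding f(1) Id Comp[OF 4(1,2) f(3,2)]
    proof (rule eq[OF 4(1)])
      show k: "compose (snd a) (\<lambda>b\<in>snd b. b) k = k"
        using f(3) by (auto simp: compose_def PiE_iff extensional_def fun_eq_iff)
    qed auto
  next
    case (5 a b c d f g h)
    obtain k \<phi> where f: "f = (push_cells (snd a) (fst a) k \<phi>, k)" "cell_map (fst a) (fst b) k \<phi>"
      "k \<in> snd a \<rightarrow>\<^sub>E snd b"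
      using HomE[OF 5(1,2,5)] by blast
    obtain l \<psi> where g: "g = (push_cells (snd b) (fst b) l \<psi>, l)" "cell_map (fst b) (fst c) l \<psi>"
      "l \<in> snd b \<rightarrow>\<^sub>E snd c"
      using HomE[OF 5(2,3,6)] by blast
    obtain m \<chi> where h: "h = (push_cells (snd c) (fst c) m \<chi>, m)"
      using HomE[OF 5(3,4,7)] by blast
    show ?case
      unfolding f(1) g(1) h Comp[OF 5(1,2) f(3,2)] Comp[OF 5(2,3) g(3,2)]
        Comp[OF 5(1,3) compE[OF f(3) g(3)] cell_map_comp[OF f(2) g(2) cm[OF 5(1)]]]
    proof (rule eq[OF 5(1)])
      show "compose (snd a) (compose (snd b) m l) k = compose (snd a) m (compose (snd a) l k)"
        using f(3) by (auto simp: compose_def fun_eq_iff)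
    next
      fix n x y q assume "q \<in> obj_map (fst a) n x y"
      then show "\<chi> n (l (k x)) (l (k y)) (\<psi> n (k x) (k y) (\<phi> n x y q)) =
        \<chi> n (compose (snd a) l k x) (compose (snd a) l k y) (\<psi> n (k x) (k y) (\<phi> n x y q))"
        by (auto simp: compose_def dest: colax_monoidal.mem_base[OF cm[OF 5(1)]])
    qed
  qed
qed

text \<open>Inverting a cell map pointwise gives a cell map again: its compatibility with the
  structure can be tested after applying the injective \<phi>.\<close>

lemma iso_in_TSet:
  fixes X Y :: "('u, 'u) colax"
  assumes X: "(X, S) \<in> Ob TSet" and Y: "(Y, T) \<in> Ob TSet"
    and f: "f \<in> S \<rightarrow>\<^sub>E T" "bij_betw f S T" and \<phi>: "cell_map X Y f \<phi>"
    and bij: "\<And>n a b. \<lbrakk>a \<in> S; b \<in> S\<rbrakk> \<Longrightarrow> bij_betw (\<phi> n a b) (obj_map X n a b) (obj_map Y n (f a) (f b))"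
  shows "iso_in TSet (X, S) (Y, T) (push_cells S X f \<phi>, f)"
proof -
  interpret X: colax_monoidal S X using X by (simp add: Ob_TSet)
  interpret Y: colax_monoidal T Y using Y by (simp add: Ob_TSet)
  define g where "g = (\<lambda>t\<in>T. inv_into S f t)"
  define \<psi> where "\<psi> n x y p = inv_into (obj_map X n (g x) (g y)) (\<phi> n (g x) (g y)) p" for n x y p
  have gS: "g t \<in> S" "f (g t) = t" if "t \<in> T" for t
    using that f by (auto simp: g_def bij_betw_def inv_into_into f_inv_into_f)
  have fT: "f a \<in> T" "g (f a) = a" if "a \<in> S" for a
    using that f by (auto simp: g_def bij_betw_def)
  note D = cell_mapD[OF \<phi>]
  have \<psi>: "\<psi> n x y p \<in> obj_map X n (g x) (g y)" "\<phi> n (g x) (g y) (\<psi> n x y p) = p"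
    if p: "p \<in> obj_map Y n x y" for n x y p
  proof -
    have "p \<in> \<phi> n (g x) (g y) ` obj_map X n (g x) (g y)"
      using bij[of "g x" "g y" n] Y.mem_base[OF p] gS p by (auto simp: bij_betw_def)
    then show "\<psi> n x y p \<in> obj_map X n (g x) (g y)" "\<phi> n (g x) (g y) (\<psi> n x y p) = p"
      unfolding \<psi>_def by (auto intro: inv_into_into f_inv_into_f)
  qed
  have inj: "q = r" if "q \<in> obj_map X n a b" "r \<in> obj_map X n a b" "\<phi> n a b q = \<phi> n a b r" for q r n a b
    using bij[of a b n] X.mem_base[OF that(1)] that by (auto simp: bij_betw_def inj_on_def)
  have \<psi>\<phi>: "\<psi> n (f a) (f b) (\<phi> n a b q) = q" if q: "q \<in> obj_map X n a b" for n a b q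
  proof (rule inj[of _ n a b])
    show "\<psi> n (f a) (f b) (\<phi> n a b q) \<in> obj_map X n a b"
      "\<phi> n a b (\<psi> n (f a) (f b) (\<phi> n a b q)) = \<phi> n a b q"
      using \<psi>[OF D(1)[OF q]] X.mem_base[OF q] by (simp_all add: fT)
  qed (rule q)
  have cell: "cell_map Y X g \<psi>"
    unfolding cell_map_def
  proof (intro conjI allI impI)
    fix n x y p assume "p \<in> obj_map Y n x y"
    then show "\<psi> n x y p \<in> obj_map X n (g x) (g y)" by (rule \<psi>)
  next
    fix m n h x y p assume h: "h \<in> Hom Delta_f n m" and p: "p \<in> obj_map Y m x y"
    show "\<psi> n x y (arr_map Y m n h x y p) = arr_map X m n h (g x) (g y) (\<psi> m x y p)"
    proof (rule inj[of _ n "g x" "g y"])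
      show "\<phi> n (g x) (g y) (\<psi> n x y (arr_map Y m n h x y p)) =
        \<phi> n (g x) (g y) (arr_map X m n h (g x) (g y) (\<psi> m x y p))"
        using D(2)[OF h \<psi>(1)[OF p]] Y.mem_base[OF p]
        by (simp add: gS \<psi>(2)[OF Y.arr_in[OF h p]] \<psi>(2)[OF p])
    qed (rule \<psi>(1)[OF Y.arr_in[OF h p]] X.arr_in[OF h \<psi>(1)[OF p]])+
  next
    fix m n x y c p u v assume p: "p \<in> obj_map Y (m + n) x y" and c: "comult Y m n x y p = (c, u, v)"
    note cm = Y.comult_mem[OF p c]
    obtain c' u' v' where c': "comult X m n (g x) (g y) (\<psi> (m + n) x y p) = (c', u', v')"
      using prod_cases3 by blast
    note cm' = X.comult_mem[OF \<psi>(1)[OF p] c']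
    \<comment> \<open>The cut of \<open>p\<close> is the image of the cut of its preimage; \<psi>
      then undoes \<phi> on each of the two pieces.\<close>
    have "(c, u, v) = (f c', \<phi> m (g x) c' u', \<phi> n c' (g y) v')"
      using D(3)[OF \<psi>(1)[OF p] c'] c Y.mem_base[OF p] by (simp add: \<psi>[OF p] gS)
    then have "c = f c'" "u = \<phi> m (g x) c' u'" "v = \<phi> n c' (g y) v'" by auto
    with cm' \<psi>\<phi>[OF cm'(2)] \<psi>\<phi>[OF cm'(3)] Y.mem_base[OF p]
    show "comult X m n (g x) (g y) (\<psi> (m + n) x y p) = (g c, \<psi> m x c u, \<psi> n c y v)"
      by (simp add: c' gS fT)
  qed
  have fF: "f \<in> S \<rightarrow> T" and gF: "g \<in> T \<rightarrow> S" and gE: "g \<in> T \<rightarrow>\<^sub>E S"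
    using f gS by (auto simp: g_def)
  have gf: "compose S g f = (\<lambda>a\<in>S. a)" and fg: "compose T f g = (\<lambda>t\<in>T. t)"
    by (auto simp: compose_def fun_eq_iff gS fT)
  have "Comp TSet (X, S) (Y, T) (X, S) (push_cells T Y g \<psi>, g) (push_cells S X f \<phi>, f) = Id TSet (X, S)"
    using Comp_TSet[OF X.colax_monoidal_axioms fF \<phi> Y.colax_monoidal_axioms]
    by (simp add: Id_TSet gf X.push_cells_eq_iff \<psi>\<phi>)
  moreover have "Comp TSet (Y, T) (X, S) (Y, T) (push_cells S X f \<phi>, f) (push_cells T Y g \<psi>, g) = Id TSet (Y, T)"
    using Comp_TSet[OF Y.colax_monoidal_axioms gF cell X.colax_monoidal_axioms]
    by (simp add: Id_TSet fg Y.push_cells_eq_iff \<psi>)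
  moreover have "(push_cells S X f \<phi>, f) \<in> Hom TSet (X, S) (Y, T)"
    using f \<phi> by (auto simp: Hom_TSet_iff[OF X.colax_monoidal_axioms Y.colax_monoidal_axioms])
  moreover have "(push_cells T Y g \<psi>, g) \<in> Hom TSet (Y, T) (X, S)"
    using gE cell by (auto simp: Hom_TSet_iff[OF Y.colax_monoidal_axioms X.colax_monoidal_axioms])
  ultimately show ?thesis unfolding iso_in_def by blast
qed

section \<open>From simplicial sets to templicial sets\<close>

context simplicial_set
begin

definition colax_of :: "('e, 'e) colax" where
  "colax_of = (let Q = \<lambda>n a b. {x \<in> K n. face n 0 0 x = a \<and> face n n n x = b} in
    \<lparr>obj_map = Q,
     arr_map = (\<lambda>m n h a b. \<lambda>x\<in>Q m a b. act m n h x),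
     comult = (\<lambda>m n a b. \<lambda>x\<in>Q (m + n) a b.
       (face (m + n) m m x, face (m + n) 0 m x, face (m + n) m (m + n) x)),
     counit = (\<lambda>a b. \<lambda>x\<in>Q 0 a b. ())\<rparr>)"

lemma mem_colax_of: "x \<in> obj_map colax_of n a b \<longleftrightarrow> x \<in> K n \<and> face n 0 0 x = a \<and> face n n n x = b"
  by (simp add: colax_of_def)

lemma arr_map_colax_of: "x \<in> obj_map colax_of m a b \<Longrightarrow> arr_map colax_of m n h a b x = act m n h x"
  by (simp add: colax_of_def)

lemma comult_colax_of:
  "x \<in> obj_map colax_of (m + n) a b \<Longrightarrow>
    comult colax_of m n a b x = (face (m + n) m m x, face (m + n) 0 m x, face (m + n) m (m + n) x)"
  by (simp add: colax_of_def)

lemma vertex_in: "\<lbrakk>i \<le> n; x \<in> K n\<rbrakk> \<Longrightarrow> face n i i x \<in> K 0"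
  using face_in[of i i n x] by simp

text \<open>The restriction of \<open>h\<close> to a single vertex is the identity of
  \<open>[0]\<close>, so only the choice of vertex changes. For \<open>h\<close> in
  \<open>Delta_f\<close> the end vertices are therefore preserved.\<close>

lemma vertex_act:
  assumes "h \<in> Hom Delta m n" "k \<le> m" "x \<in> K n"
  shows "face m k k (act n m h x) = face n (h k) (h k) x"
proof -
  have "seg h k k = (\<lambda>i\<in>{0..0}. i)" by (auto simp: seg_def)
  then show ?thesis
    using face_act[OF assms(1) order_refl assms(2,3)] DeltaD(1)[OF assms(1,2)] assms(3)
    using act_id[OF vertex_in, of "h k" n x] by simp
qed

lemma act_in_colax_of:
  assumes "h \<in> Hom Delta_f n m" "x \<in> obj_map colax_of m a b"
  shows "act m n h x \<in> obj_map colax_of n a b"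
  using assms vertex_act[of h n m 0 x] vertex_act[of h n m n x]
  by (auto simp: mem_colax_of mem_Delta_f act_in)

lemma comult_mem_colax_of:
  assumes "x \<in> obj_map colax_of (m + n) a b"
  shows "face (m + n) m m x \<in> K 0"
    "face (m + n) 0 m x \<in> obj_map colax_of m a (face (m + n) m m x)"
    "face (m + n) m (m + n) x \<in> obj_map colax_of n (face (m + n) m m x) b"
  using assms face_in[of 0 m "m + n" x] face_in[of m "m + n" "m + n" x]
  by (auto simp: mem_colax_of face_face vertex_in)

text \<open>The axioms become statements about intervals of vertices: naturality is
  \<open>face_act\<close> on the two summands of a sum, and both bracketings in coassociativity give
  the restrictions to the same three consecutive intervals, by \<open>face_face\<close>.\<close>

lemma colax_monoidal_colax_of: "colax_monoidal (K 0) colax_of"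
proof (rule colax_monoidalI, goal_cases)
  case (1 n)
  then show ?case by (auto simp: quiver_on_def mem_colax_of vertex_in)
next
  case (2 m n h)
  have "(\<lambda>a b. \<lambda>x\<in>obj_map colax_of m a b. act m n h x) \<in> quiv_hom (obj_map colax_of m) (obj_map colax_of n)"
    using act_in_colax_of[OF 2] by (rule quiv_hom_restrictI)
  then show ?case by (simp add: colax_of_def)
next
  case (3 n a b x)
  then show ?case by (simp add: arr_map_colax_of) (simp add: mem_colax_of act_id)
next
  case (4 l m n h g a b x)
  then show ?case
    by (simp add: arr_map_colax_of act_in_colax_of)
      (simp add: mem_colax_of act_compose mem_Delta_f)
next
  case (5 m n)
  have "(\<lambda>a b. \<lambda>x\<in>obj_map colax_of (m + n) a b. (face (m + n) m m x, face (m + n) 0 m x, face (m + n) m (m + n) x))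
      \<in> quiv_hom (obj_map colax_of (m + n)) (tensor (K 0) (obj_map colax_of m) (obj_map colax_of n))"
    using comult_mem_colax_of by (intro quiv_hom_restrictI) (simp add: mem_tensor)
  then show ?case by (simp add: colax_of_def)
next
  case (6 a b x)
  then show ?case by (auto simp: mem_colax_of)
next
  case (7 m m' n n' f g a b c x y z)
  let ?h = "Delta_f_add m m' n f g"
  have h: "?h \<in> Hom Delta_f (m + n) (m' + n')"
    using 7 by (intro Delta_f_add_in_Hom)
  then have hD: "?h \<in> Hom Delta (m + n) (m' + n')" by (simp add: mem_Delta_f)
  have x: "x \<in> K (m' + n')" using 7 by (simp add: mem_colax_of)
  note s = seg_Delta_f_add[OF 7(1,2)]
  note c = comult_colax_of[OF 7(3)] comult_mem_colax_of[OF 7(3)]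
  show ?case
    using 7(3,4) c face_act[OF hD _ _ x, of 0 m] face_act[OF hD _ _ x, of m "m + n"] vertex_act[OF hD _ x, of m]
    by (auto simp: arr_map_colax_of comult_colax_of act_in_colax_of[OF h] s)
next
  case (8 l m n a b c d x u r q p)
  have x': "x \<in> obj_map colax_of (l + (m + n)) a b" and x: "x \<in> K (l + m + n)"
    using 8(1) by (simp_all add: add.assoc mem_colax_of)
  note c = comult_colax_of[OF 8(1)] comult_mem_colax_of[OF 8(1)]
  note c' = comult_colax_of[OF x'] comult_mem_colax_of[OF x']
  show ?case
    using 8 c c' x
    by (auto simp: comult_colax_of face_face add.assoc)
next
  case (9 n a b c x u q)
  then show ?case using comult_colax_of[of x 0 n a b] by (simp add: mem_colax_of face_all)
next
  case (10 n a b c x u q)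
  then show ?case using comult_colax_of[of x n 0 a b] by (simp add: mem_colax_of face_all)
qed

text \<open>A 0-simplex is its own first and last vertex.\<close>

lemma strongly_unital_colax_of: "strongly_unital (K 0) colax_of"
proof -
  interpret C: colax_monoidal "K 0" colax_of by (rule colax_monoidal_colax_of)
  have "obj_map colax_of 0 a a = {a}" if "a \<in> K 0" for a
    using that by (auto simp: mem_colax_of face_all)
  then show ?thesis unfolding C.strongly_unital_iff by blast
qed

end

section \<open>Simplicial sets as functors, and their morphisms on elements\<close>

lemma Ob_SSet: "K \<in> Ob SSet \<longleftrightarrow> cat_functor (op_cat Delta) Set_cat K"
  by (simp add: SSet_def functor_category_def)

text \<open>Arrows of \<open>Set_cat\<close> are functions restricted to their domain, which
  \<open>simplicial_set\<close> does not ask for; the second assumption supplies it.\<close>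

lemma SSet_ObI:
  fixes K :: "'u sset"
  assumes "simplicial_set (obj_map K) (arr_map K)"
    and "\<And>m n h. h \<in> Hom Delta m n \<Longrightarrow> arr_map K n m h \<in> extensional (obj_map K n)"
  shows "K \<in> Ob SSet"
proof -
  interpret simplicial_set "obj_map K" "arr_map K" by fact
  interpret D: category "op_cat Delta" by (intro category_op category_Delta)
  interpret S: category Set_cat by (rule category_Set_cat)
  have "cat_functor (op_cat Delta) Set_cat K"
  proof (unfold_locales, goal_cases)
    case (2 n m h)
    then show ?case using assms(2) by (auto simp: op_cat_def Set_cat_def PiE_iff act_in)
  next
    case (3 n)
    then show ?case using assms(2)[OF id_in_Delta, of n]
      by (auto simp: op_cat_def Set_cat_def Delta_def act_id intro!: extensionalityI[of _ "obj_map K n"])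
  next
    case (4 n m l g h)
    then have h: "h \<in> Hom Delta l m" and g: "g \<in> Hom Delta m n" by (auto simp: op_cat_def)
    have "arr_map K n l (compose {0..l} g h) = compose (obj_map K n) (arr_map K m l h) (arr_map K n m g)"
      using assms(2)[OF compose_in_Delta[OF h g]]
      by (intro extensionalityI[of _ "obj_map K n"]) (auto simp: act_compose[OF h g] compose_eq)
    then show ?case by (simp add: op_cat_def Set_cat_def Delta_def)
  qed (simp_all add: Set_cat_def)
  then show ?thesis by (simp add: Ob_SSet)
qed

lemma simplicial_set_SSet:
  assumes "K \<in> Ob SSet"
  shows "simplicial_set (obj_map K) (arr_map K)"
proof -
  interpret cat_functor "op_cat Delta" Set_cat K using assms by (simp add: Ob_SSet)
  show ?thesis
  proof
    fix h m n x assume "h \<in> Hom Delta m n" "x \<in> obj_map K n"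
    then show "arr_map K n m h x \<in> obj_map K m"
      using arr_map_in_Hom[of n m h] by (auto simp: op_cat_def Set_cat_def Delta_def)
  next
    fix x n assume "x \<in> obj_map K n"
    then show "arr_map K n n (\<lambda>i\<in>{0..n}. i) x = x"
      using arr_map_Id[of n] by (simp add: op_cat_def Set_cat_def Delta_def)
  next
    fix h l m g n x assume "h \<in> Hom Delta l m" "g \<in> Hom Delta m n" "x \<in> obj_map K n"
    then show "arr_map K n l (compose {0..l} g h) x = arr_map K m l h (arr_map K n m g x)"
      using arr_map_Comp[of n m l g h] by (simp add: op_cat_def Set_cat_def Delta_def compose_eq)
  qed
qed

lemma Hom_SSet_iff:
  assumes K: "K \<in> Ob SSet" and L: "L \<in> Ob SSet"
  shows "\<tau> \<in> Hom SSet K L \<longleftrightarrow> (\<forall>n. \<tau> n \<in> obj_map K n \<rightarrow>\<^sub>E obj_map L n) \<and>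
    (\<forall>m n h x. h \<in> Hom Delta m n \<longrightarrow> x \<in> obj_map K n \<longrightarrow> \<tau> m (arr_map K n m h x) = arr_map L n m h (\<tau> n x))"
proof -
  have K': "cat_functor (op_cat Delta) Set_cat K" and L': "cat_functor (op_cat Delta) Set_cat L"
    using K L by (auto simp: Ob_SSet)
  have compose_eq_iff: "compose A g f = compose A g' f' \<longleftrightarrow> (\<forall>x\<in>A. g (f x) = g' (f' x))"
    for A :: "'a set" and g f g' f' :: "'a \<Rightarrow> 'a"
    by (auto simp: compose_def fun_eq_iff)
  show ?thesis
    unfolding SSet_def functor_category_def natural_transformation_def natural_transformation_axioms_def
    using K' L'
    by (auto simp: op_cat_def Set_cat_def Delta_def compose_eq_iff extensional_def)
qed


lemma category_SSet: "category SSet"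
  unfolding SSet_def
  by (intro category_functor_category category_op category_Delta category_Set_cat)

section \<open>The functor from simplicial sets to templicial sets, and its full
  faithfulness\<close>

definition face :: "'u sset \<Rightarrow> nat \<Rightarrow> nat \<Rightarrow> nat \<Rightarrow> 'u \<Rightarrow> 'u" where
  "face K = simplicial_set.face (arr_map K)"

definition templicial_of :: "'u sset \<Rightarrow> ('u, 'u) colax" where
  "templicial_of K = simplicial_set.colax_of (obj_map K) (arr_map K)"

definition templicial_functor :: "('u sset, nat \<Rightarrow> 'u \<Rightarrow> 'u, 'u templicial, 'u templicial_map) fctr" where
  "templicial_functor =
    \<lparr>obj_map = (\<lambda>K. (templicial_of K, obj_map K 0)),
     arr_map = (\<lambda>K L \<tau>. (push_cells (obj_map K 0) (templicial_of K) (\<tau> 0) (\<lambda>n a b. \<tau> n), \<tau> 0))\<rparr>"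

lemma colax_monoidal_templicial_of: "K \<in> Ob SSet \<Longrightarrow> colax_monoidal (obj_map K 0) (templicial_of K)"
  unfolding templicial_of_def by (intro simplicial_set.colax_monoidal_colax_of simplicial_set_SSet)

lemma templicial_Ob: "K \<in> Ob SSet \<Longrightarrow> (templicial_of K, obj_map K 0) \<in> Ob TSet"
  unfolding templicial_of_def Ob_TSet
  by (intro conjI simplicial_set.colax_monoidal_colax_of simplicial_set.strongly_unital_colax_of simplicial_set_SSet)

lemma sset_map_face:
  assumes K: "K \<in> Ob SSet" and L: "L \<in> Ob SSet" and "\<tau> \<in> Hom SSet K L"
    and "i \<le> j" "j \<le> n" "x \<in> obj_map K n"
  shows "\<tau> (j - i) (face K n i j x) = face L n i j (\<tau> n x)"
  using assms by (simp add: face_def simplicial_set.face_def[OF simplicial_set_SSet[OF K]]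
    simplicial_set.face_def[OF simplicial_set_SSet[OF L]] Hom_SSet_iff interval_map_in_Delta)

lemma cell_map_sset_map:
  assumes K: "K \<in> Ob SSet" and L: "L \<in> Ob SSet" and \<tau>: "\<tau> \<in> Hom SSet K L"
  shows "cell_map (templicial_of K) (templicial_of L) (\<tau> 0) (\<lambda>n a b. \<tau> n)"
proof -
  interpret K: simplicial_set "obj_map K" "arr_map K" by (rule simplicial_set_SSet[OF K])
  interpret L: simplicial_set "obj_map L" "arr_map L" by (rule simplicial_set_SSet[OF L])
  note F = sset_map_face[OF K L \<tau>]
  have vertex: "\<tau> 0 (face K n i i x) = face L n i i (\<tau> n x)" if "i \<le> n" "x \<in> obj_map K n" for n i x
    using F[OF order_refl that] by simp
  have in_L: "\<tau> n x \<in> obj_map L n" if "x \<in> obj_map K n" for n x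
    using \<tau> that by (auto simp: Hom_SSet_iff[OF K L])
  have cell: "\<tau> n x \<in> obj_map (templicial_of L) n (\<tau> 0 a) (\<tau> 0 b)" if "x \<in> obj_map (templicial_of K) n a b" for n a b x
    using that vertex[of 0 n x] vertex[of n n x] in_L
    by (auto simp: templicial_of_def K.mem_colax_of L.mem_colax_of face_def[symmetric])
  show ?thesis
    unfolding cell_map_def
  proof (intro conjI allI impI)
    fix n a b q assume "q \<in> obj_map (templicial_of K) n a b"
    then show "\<tau> n q \<in> obj_map (templicial_of L) n (\<tau> 0 a) (\<tau> 0 b)" by (rule cell)
  next
    fix m n h a b q assume "h \<in> Hom Delta_f n m" and q: "q \<in> obj_map (templicial_of K) m a b"
    then show "\<tau> n (arr_map (templicial_of K) m n h a b q) = arr_map (templicial_of L) m n h (\<tau> 0 a) (\<tau> 0 b) (\<tau> m q)"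
      using \<tau> cell[OF q] by (simp add: Hom_SSet_iff[OF K L] templicial_of_def K.arr_map_colax_of L.arr_map_colax_of
        K.mem_colax_of mem_Delta_f)
  next
    fix m n a b c q y z
    assume q: "q \<in> obj_map (templicial_of K) (m + n) a b" and c: "comult (templicial_of K) m n a b q = (c, y, z)"
    have qK: "q \<in> obj_map K (m + n)" using q by (simp add: templicial_of_def K.mem_colax_of)
    have "c = face K (m + n) m m q" "y = face K (m + n) 0 m q" "z = face K (m + n) m (m + n) q"
      using c q by (simp_all add: templicial_of_def K.comult_colax_of face_def)
    then show "comult (templicial_of L) m n (\<tau> 0 a) (\<tau> 0 b) (\<tau> (m + n) q) = (\<tau> 0 c, \<tau> m y, \<tau> n z)"
      using cell[OF q] F[of m m "m + n" q] F[of 0 m "m + n" q] F[of m "m + n" "m + n" q] qK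
      by (simp add: templicial_of_def L.comult_colax_of face_def)
  qed
qed

text \<open>The converse: a cell map commutes with the comultiplications, hence with all faces onto
  intervals, and every map of \<open>Delta\<close> factors as a map of \<open>Delta_f\<close> followed by the inclusion of
  an interval.\<close>

lemma sset_map_of_cell_map:
  assumes K: "K \<in> Ob SSet" and L: "L \<in> Ob SSet"
    and f: "f \<in> obj_map K 0 \<rightarrow>\<^sub>E obj_map L 0" and \<phi>: "cell_map (templicial_of K) (templicial_of L) f \<phi>"
  defines "\<tau> \<equiv> \<lambda>n. \<lambda>x\<in>obj_map K n. \<phi> n (face K n 0 0 x) (face K n n n x) x"
  shows "\<tau> \<in> Hom SSet K L" "\<tau> 0 = f"
    "x \<in> obj_map (templicial_of K) n a b \<Longrightarrow> \<tau> n x = \<phi> n a b x"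
proof -
  interpret K: simplicial_set "obj_map K" "arr_map K" by (rule simplicial_set_SSet[OF K])
  interpret L: simplicial_set "obj_map L" "arr_map L" by (rule simplicial_set_SSet[OF L])
  interpret CK: colax_monoidal "obj_map K 0" "templicial_of K" by (rule colax_monoidal_templicial_of[OF K])
  note D = cell_mapD[OF \<phi>]
  have mem: "x \<in> obj_map (templicial_of K) n a b \<longleftrightarrow> x \<in> obj_map K n \<and> face K n 0 0 x = a \<and> face K n n n x = b" for x n a b
    by (simp add: templicial_of_def K.mem_colax_of face_def)
  have memL: "x \<in> obj_map (templicial_of L) n a b \<longleftrightarrow> x \<in> obj_map L n \<and> face L n 0 0 x = a \<and> face L n n n x = b" for x n a b
    by (simp add: templicial_of_def L.mem_colax_of face_def)
  have \<tau>: "\<tau> n x = \<phi> n a b x" if "x \<in> obj_map (templicial_of K) n a b" for n a b x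
    using that by (auto simp: \<tau>_def mem)
  then show "x \<in> obj_map (templicial_of K) n a b \<Longrightarrow> \<tau> n x = \<phi> n a b x" .
  have cell: "x \<in> obj_map (templicial_of K) n (face K n 0 0 x) (face K n n n x)" if "x \<in> obj_map K n" for x n
    using that by (simp add: mem)
  have in_L: "\<tau> n x \<in> obj_map L n" if "x \<in> obj_map K n" for n x
    using D(1)[OF cell[OF that]] \<tau>[OF cell[OF that]] by (simp add: memL)
  \<comment> \<open>Cutting at \<open>m\<close> yields the initial and the final face together, so
    one use of compatibility with the comultiplication treats both.\<close>
  have faces: "\<tau> m (face K n 0 m x) = face L n 0 m (\<tau> n x) \<and> \<tau> (n - m) (face K n m n x) = face L n m n (\<tau> n x)"
    if x: "x \<in> obj_map K n" and "m \<le> n" for m n x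
  proof -
    have n: "n = m + (n - m)" using that by simp
    let ?a = "face K n 0 0 x" and ?b = "face K n n n x" and ?c = "face K n m m x"
    have c: "x \<in> obj_map (templicial_of K) (m + (n - m)) ?a ?b"
      using cell[OF x] n by simp
    have s: "comult (templicial_of K) m (n - m) ?a ?b x = (?c, face K n 0 m x, face K n m n x)"
      using K.comult_colax_of[OF c[unfolded templicial_of_def]] n by (simp add: templicial_of_def face_def)
    note cm = CK.comult_mem[OF c s]
    have "comult (templicial_of L) m (n - m) (f ?a) (f ?b) (\<tau> n x) = (f ?c, \<tau> m (face K n 0 m x), \<tau> (n - m) (face K n m n x))"
      using D(3)[OF c s] n \<tau>[OF cm(2)] \<tau>[OF cm(3)] \<tau>[OF cell[OF x]] by simp
    moreover have "\<tau> n x \<in> obj_map (templicial_of L) (m + (n - m)) (f ?a) (f ?b)"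
      using D(1)[OF cell[OF x]] \<tau>[OF cell[OF x]] n by simp
    ultimately show ?thesis
      using L.comult_colax_of[of "\<tau> n x" m "n - m" "f ?a" "f ?b"] n by (simp add: templicial_of_def face_def)
  qed
  \<comment> \<open>An arbitrary interval is a final face of an initial face.\<close>
  have face: "\<tau> (j - i) (face K n i j x) = face L n i j (\<tau> n x)"
    if x: "x \<in> obj_map K n" and ij: "i \<le> j" "j \<le> n" for i j n x
  proof -
    have 1: "face K n 0 j x \<in> obj_map K j" using K.face_in[of 0 j n x] ij x by (simp add: face_def)
    have "face K n i j x = face K j i j (face K n 0 j x)"
      using K.face_face[of 0 j n i j x j] ij x by (simp add: face_def)
    also have "\<tau> (j - i) \<dots> = face L j i j (face L n 0 j (\<tau> n x))"
      using faces[OF 1 ij(1)] faces[OF x ij(2)] by simp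
    also have "\<dots> = face L n i j (\<tau> n x)"
      using L.face_face[of 0 j n i j "\<tau> n x" j] ij in_L[OF x] by (simp add: face_def)
    finally show ?thesis .
  qed
  have inner: "\<tau> m (arr_map K n m h x) = arr_map L n m h (\<tau> n x)"
    if h: "h \<in> Hom Delta_f m n" and x: "x \<in> obj_map K n" for h m n x
  proof -
    note c = cell[OF x]
    have "arr_map (templicial_of K) n m h (face K n 0 0 x) (face K n n n x) x = arr_map K n m h x"
      using K.arr_map_colax_of[OF c[unfolded templicial_of_def]] by (simp add: templicial_of_def)
    moreover have "arr_map (templicial_of L) n m h (f (face K n 0 0 x)) (f (face K n n n x)) (\<tau> n x) = arr_map L n m h (\<tau> n x)"
      using L.arr_map_colax_of[OF D(1)[OF c, unfolded templicial_of_def]] \<tau>[OF c] by (simp add: templicial_of_def)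
    ultimately show ?thesis
      using D(2)[OF h c] \<tau>[OF c] \<tau>[OF CK.arr_in[OF h c]] by simp
  qed
  show "\<tau> \<in> Hom SSet K L"
    unfolding Hom_SSet_iff[OF K L]
  proof (intro conjI allI impI)
    fix n show "\<tau> n \<in> obj_map K n \<rightarrow>\<^sub>E obj_map L n"
      using in_L by (auto simp: \<tau>_def)
  next
    fix m n h x assume h: "h \<in> Hom Delta m n" and x: "x \<in> obj_map K n"
    have le: "h 0 \<le> h m" "h m \<le> n" using DeltaD[OF h] by auto
    have s: "seg h 0 m \<in> Hom Delta_f m (h m - h 0)" using seg_in_Delta_f[OF h, of 0 m] by simp
    have 1: "face K n (h 0) (h m) x \<in> obj_map K (h m - h 0)"
      using K.face_in[OF le x] by (simp add: face_def)
    show "\<tau> m (arr_map K n m h x) = arr_map L n m h (\<tau> n x)"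
      using K.act_face[OF h x] L.act_face[OF h in_L[OF x]] inner[OF s 1] face[OF x le]
      by (simp add: face_def)
  qed
  \<comment> \<open>A 0-simplex \<open>x\<close> is a cell from \<open>x\<close> to
    \<open>x\<close>, so its image is a cell from \<open>f x\<close> to \<open>f x\<close>. Such a
    cell in degree 0 is its own vertex, hence equals \<open>f x\<close>.\<close>
  show "\<tau> 0 = f"
  proof (rule extensionalityI[of _ "obj_map K 0"])
    fix x assume x: "x \<in> obj_map K 0"
    then have c: "x \<in> obj_map (templicial_of K) 0 x x"
      using K.face_all[OF x] by (simp add: mem face_def)
    from D(1)[OF c] have "face L 0 0 0 (\<phi> 0 x x x) = f x" "\<phi> 0 x x x \<in> obj_map L 0" by (simp_all add: memL)
    then show "\<tau> 0 x = f x" using \<tau>[OF c] L.face_all[of "\<phi> 0 x x x" 0] by (simp add: face_def)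
  qed (use f in \<open>auto simp: \<tau>_def PiE_iff\<close>)
qed

lemma sset_map_base:
  assumes "K \<in> Ob SSet" "L \<in> Ob SSet" "\<tau> \<in> Hom SSet K L"
  shows "\<tau> 0 \<in> obj_map K 0 \<rightarrow>\<^sub>E obj_map L 0"
  using assms(3) unfolding Hom_SSet_iff[OF assms(1,2)] by blast

lemma Comp_SSet: "Comp SSet K L M \<sigma> \<tau> = (\<lambda>n. compose (obj_map K n) (\<sigma> n) (\<tau> n))"
  by (simp add: SSet_def functor_category_def op_cat_def Set_cat_def Delta_def restrict_UNIV)

lemma Id_SSet: "Id SSet K = (\<lambda>n. \<lambda>x\<in>obj_map K n. x)"
  by (simp add: SSet_def functor_category_def op_cat_def Set_cat_def Delta_def restrict_UNIV)

lemma mem_templicial_of: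
  "K \<in> Ob SSet \<Longrightarrow> x \<in> obj_map (templicial_of K) n a b \<longleftrightarrow> x \<in> obj_map K n \<and> face K n 0 0 x = a \<and> face K n n n x = b"
  by (simp add: templicial_of_def face_def simplicial_set.mem_colax_of[OF simplicial_set_SSet])

lemma cat_functor_templicial: "cat_functor SSet TSet templicial_functor"
proof -
  interpret S: category SSet by (rule category_SSet)
  interpret T: category TSet by (rule category_TSet)
  show ?thesis
  proof (unfold_locales, goal_cases)
    case (1 K)
    then show ?case by (simp add: templicial_functor_def templicial_Ob)
  next
    case (2 K L \<tau>)
    then show ?case
      using cell_map_sset_map[OF 2] sset_map_base[OF 2]
      by (auto simp: templicial_functor_def Hom_TSet_iff colax_monoidal_templicial_of)
  next
    case (3 K)
    interpret colax_monoidal "obj_map K 0" "templicial_of K" using 3 by (rule colax_monoidal_templicial_of)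
    show ?case
      using 3 by (simp add: templicial_functor_def Id_TSet Id_SSet push_cells_eq_iff mem_templicial_of)
  next
    case (4 K L M \<tau> \<sigma>)
    interpret colax_monoidal "obj_map K 0" "templicial_of K" using 4(1) by (rule colax_monoidal_templicial_of)
    have \<tau>0: "\<tau> 0 \<in> obj_map K 0 \<rightarrow> obj_map L 0"
      using sset_map_base[OF 4(1,2,4)] by auto
    show ?case
      using 4(1,2) Comp_TSet[OF colax_monoidal_axioms \<tau>0 cell_map_sset_map[OF 4(1,2,4)]]
      by (simp add: templicial_functor_def Comp_SSet push_cells_eq_iff mem_templicial_of colax_monoidal_templicial_of compose_eq)
  qed
qed

lemma bij_betw_templicial_functor:
  assumes K: "K \<in> Ob SSet" and L: "L \<in> Ob SSet"
  shows "bij_betw (arr_map templicial_functor K L) (Hom SSet K L)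
    (Hom TSet (obj_map templicial_functor K) (obj_map templicial_functor L))"
proof -
  interpret CK: colax_monoidal "obj_map K 0" "templicial_of K" by (rule colax_monoidal_templicial_of[OF K])
  interpret G: cat_functor SSet TSet templicial_functor by (rule cat_functor_templicial)
  have "inj_on (arr_map templicial_functor K L) (Hom SSet K L)"
  proof (rule inj_onI)
    fix \<sigma> \<tau> assume s: "\<sigma> \<in> Hom SSet K L" and t: "\<tau> \<in> Hom SSet K L"
      and eq: "arr_map templicial_functor K L \<sigma> = arr_map templicial_functor K L \<tau>"
    have "\<sigma> 0 = \<tau> 0" using eq by (simp add: templicial_functor_def)
    \<comment> \<open>Every simplex is a cell between its own end vertices, so agreement on cells is
      agreement on all simplices.\<close>
    with eq have "\<sigma> n x = \<tau> n x" if "x \<in> obj_map K n" for n x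
      using that by (simp add: templicial_functor_def CK.push_cells_eq_iff mem_templicial_of K)
    moreover have "\<sigma> n \<in> extensional (obj_map K n)" "\<tau> n \<in> extensional (obj_map K n)" for n
      using s t by (auto simp: Hom_SSet_iff[OF K L] PiE_iff)
    ultimately show "\<sigma> = \<tau>"
      by (intro ext[of \<sigma> \<tau>] extensionalityI)
  qed
  moreover have "\<alpha> \<in> arr_map templicial_functor K L ` Hom SSet K L"
    if \<alpha>: "\<alpha> \<in> Hom TSet (templicial_of K, obj_map K 0) (templicial_of L, obj_map L 0)" for \<alpha>
  proof -
    obtain f \<phi> where f: "f \<in> obj_map K 0 \<rightarrow>\<^sub>E obj_map L 0" and \<phi>: "cell_map (templicial_of K) (templicial_of L) f \<phi>"
      and a: "\<alpha> = (push_cells (obj_map K 0) (templicial_of K) f \<phi>, f)"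
      using \<alpha> by (cases \<alpha>) (auto simp: Hom_TSet_iff colax_monoidal_templicial_of K L)
    define \<tau> where "\<tau> = (\<lambda>n. \<lambda>x\<in>obj_map K n. \<phi> n (face K n 0 0 x) (face K n n n x) x)"
    have t: "\<tau> \<in> Hom SSet K L" "\<tau> 0 = f"
      "\<And>x n a b. x \<in> obj_map (templicial_of K) n a b \<Longrightarrow> \<tau> n x = \<phi> n a b x"
      unfolding \<tau>_def using sset_map_of_cell_map[OF K L f \<phi>] by blast+
    have "\<alpha> = arr_map templicial_functor K L \<tau>"
      using t(2,3) by (simp add: a templicial_functor_def CK.push_cells_eq_iff)
    then show ?thesis using t(1) by blast
  qed
  ultimately show ?thesis
    using G.arr_map_in_Hom[OF K L]
    by (auto simp: bij_betw_def templicial_functor_def)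
qed

section \<open>Essential surjectivity\<close>

context colax_monoidal
begin

text \<open>The sets \<open>X_n(a, b)\<close> for different end points may overlap; the tags keep
  them apart and tell \<open>arr_map\<close> and \<open>comult\<close> where to act.\<close>

definition total_cells :: "nat \<Rightarrow> ('s \<times> 's \<times> 'q) set" where
  "total_cells n = {(a, b, x). x \<in> obj_map X n a b}"

definition total_arr :: "nat \<Rightarrow> nat \<Rightarrow> (nat \<Rightarrow> nat) \<Rightarrow> 's \<times> 's \<times> 'q \<Rightarrow> 's \<times> 's \<times> 'q" where
  "total_arr n m h = (\<lambda>(a, b, x). (a, b, arr_map X n m h a b x))"

definition left_part :: "nat \<Rightarrow> nat \<Rightarrow> 's \<times> 's \<times> 'q \<Rightarrow> 's \<times> 's \<times> 'q" where
  "left_part m n = (\<lambda>(a, b, x). case comult X m n a b x of (c, y, z) \<Rightarrow> (a, c, y))"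

definition right_part :: "nat \<Rightarrow> nat \<Rightarrow> 's \<times> 's \<times> 'q \<Rightarrow> 's \<times> 's \<times> 'q" where
  "right_part m n = (\<lambda>(a, b, x). case comult X m n a b x of (c, y, z) \<Rightarrow> (c, b, z))"

text \<open>The laws are the colax axioms read on the two pieces separately. One instance of
  coassociativity compares three consecutive pieces and so yields \<open>L_L\<close>,
  \<open>R_L\<close> and \<open>R_R\<close> together; the counit laws give \<open>L_0\<close> and
  \<open>R_0\<close>.\<close>

lemma segmented_total: "segmented total_cells total_arr left_part right_part"
proof
  fix h m n e assume "h \<in> Hom Delta_f m n" "e \<in> total_cells n"
  then show "total_arr n m h e \<in> total_cells m"
    by (auto simp: total_cells_def total_arr_def arr_in)
next
  fix e n assume "e \<in> total_cells n"
  then show "total_arr n n (\<lambda>i\<in>{0..n}. i) e = e"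
    by (auto simp: total_cells_def total_arr_def arr_id)
next
  fix h l m g n e assume "h \<in> Hom Delta_f l m" "g \<in> Hom Delta_f m n" "e \<in> total_cells n"
  then show "total_arr n l (compose {0..l} g h) e = total_arr m l h (total_arr n m g e)"
    by (auto simp: total_cells_def total_arr_def arr_comp)
next
  fix e m n assume e: "e \<in> total_cells (m + n)"
  obtain a b x where x: "e = (a, b, x)" "x \<in> obj_map X (m + n) a b"
    using e by (auto simp: total_cells_def)
  obtain c y z where c: "comult X m n a b x = (c, y, z)" by (rule prod_cases3)
  show "left_part m n e \<in> total_cells m" "right_part m n e \<in> total_cells n"
    using comult_mem[OF x(2) c] by (simp_all add: x(1) c total_cells_def left_part_def right_part_def)
next
  fix f m m' g n n' e assume f: "f \<in> Hom Delta_f m m'" and g: "g \<in> Hom Delta_f n n'" and e: "e \<in> total_cells (m' + n')"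
  obtain a b x where x: "e = (a, b, x)" "x \<in> obj_map X (m' + n') a b"
    using e by (auto simp: total_cells_def)
  obtain c y z where c: "comult X m' n' a b x = (c, y, z)"
    using prod_cases3 by blast
  show "left_part m n (total_arr (m' + n') (m + n) (Delta_f_add m m' n f g) e) = total_arr m' m f (left_part m' n' e)"
    "right_part m n (total_arr (m' + n') (m + n) (Delta_f_add m m' n f g) e) = total_arr n' n g (right_part m' n' e)"
    using comult_arr[OF f g x(2) c] by (simp_all add: x(1) c left_part_def right_part_def total_arr_def)
next
  fix e l m n assume e: "e \<in> total_cells (l + m + n)"
  obtain a b x where x: "e = (a, b, x)" "x \<in> obj_map X (l + m + n) a b"
    using e by (auto simp: total_cells_def)
  obtain d u r where d: "comult X (l + m) n a b x = (d, u, r)"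
    using prod_cases3 by blast
  obtain c q p where c: "comult X l m a d u = (c, q, p)"
    using prod_cases3 by blast
  obtain w where "comult X l (m + n) a b x = (c, q, w)" "comult X m n c b w = (d, p, r)"
    using comult_comult[OF x(2) d c] by blast
  then show "left_part l m (left_part (l + m) n e) = left_part l (m + n) e"
    "right_part l m (left_part (l + m) n e) = left_part m n (right_part l (m + n) e)"
    "right_part m n (right_part l (m + n) e) = right_part (l + m) n e"
    by (simp_all add: x(1) d c left_part_def right_part_def)
next
  fix e n assume e: "e \<in> total_cells n"
  obtain a b x where x: "e = (a, b, x)" "x \<in> obj_map X n a b"
    using e by (auto simp: total_cells_def)
  obtain c y z where c: "comult X n 0 a b x = (c, y, z)" by (rule prod_cases3)
  obtain d u v where d: "comult X 0 n a b x = (d, u, v)" by (rule prod_cases3)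
  show "left_part n 0 e = e" "right_part 0 n e = e"
    using comult_0_left[OF x(2) d] comult_0_right[OF x(2) c]
    by (simp_all add: x(1) c d left_part_def right_part_def)
qed

end

section \<open>Coding the simplices in the universe, and essential surjectivity\<close>

definition transport_sset ::
  "('e \<Rightarrow> 'u) \<Rightarrow> (nat \<Rightarrow> 'e set) \<Rightarrow> (nat \<Rightarrow> nat \<Rightarrow> (nat \<Rightarrow> nat) \<Rightarrow> 'e \<Rightarrow> 'e) \<Rightarrow> 'u sset" where
  "transport_sset \<iota> K act = \<lparr>obj_map = (\<lambda>n. \<iota> ` K n),
     arr_map = (\<lambda>n m h. \<lambda>y\<in>\<iota> ` K n. \<iota> (act n m h (inv \<iota> y)))\<rparr>"

lemma transport_sset_Ob:
  assumes \<iota>: "inj \<iota>" and "simplicial_set K act"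
  shows "transport_sset \<iota> K act \<in> Ob SSet"
proof -
  interpret simplicial_set K act by fact
  show ?thesis
  proof (rule SSet_ObI)
    show "simplicial_set (obj_map (transport_sset \<iota> K act)) (arr_map (transport_sset \<iota> K act))"
      by unfold_locales
        (auto simp: transport_sset_def inv_f_f[OF \<iota>] act_in act_id act_compose)
  qed (auto simp: transport_sset_def)
qed

text \<open>An infinite set is in bijection with its square; the pairing is used twice.\<close>

lemma infinite_triple_coding:
  assumes "infinite (UNIV :: 'u set)"
  obtains \<iota> :: "'u \<times> 'u \<times> 'u \<Rightarrow> 'u" where "inj \<iota>"
proof -
  obtain p :: "'u \<times> 'u \<Rightarrow> 'u" where "bij_betw p (UNIV \<times> UNIV) UNIV"
    using card_of_Times_same_infinite[OF assms] card_of_ordIso by blast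
  then have p: "inj p" by (simp add: bij_betw_def)
  have "inj (\<lambda>(a, b, c). p (a, p (b, c)))"
    by (auto intro!: injI dest!: injD[OF p])
  then show ?thesis by (rule that)
qed

lemma essentially_surjective_templicial_functor:
  fixes X :: "('u, 'u) colax"
  assumes inf: "infinite (UNIV :: 'u set)" and Ob: "(X, S) \<in> Ob TSet"
  shows "\<exists>K\<in>Ob SSet. \<exists>u. iso_in TSet (X, S) (obj_map templicial_functor K) u"
proof -
  interpret colax_monoidal S X using Ob by (simp add: Ob_TSet)
  interpret T: segmented total_cells total_arr left_part right_part by (rule segmented_total)
  have "\<forall>a\<in>S. \<exists>u. obj_map X 0 a a = {u}"
    using Ob strongly_unital_iff by (simp add: Ob_TSet)
  \<comment> \<open>By strong unitality, \<open>e a\<close> is the only element of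
    \<open>X_0(a, a)\<close>; the triple \<open>(a, a, e a)\<close> will be the vertex belonging to
    \<open>a\<close>.\<close>
  then obtain e where e: "\<And>a. a \<in> S \<Longrightarrow> obj_map X 0 a a = {e a}"
    by metis
  obtain \<iota> :: "'u \<times> 'u \<times> 'u \<Rightarrow> 'u" where \<iota>: "inj \<iota>"
    using infinite_triple_coding[OF inf] .
  define K where "K = transport_sset \<iota> total_cells T.segmented_act"
  have K: "K \<in> Ob SSet"
    unfolding K_def by (intro transport_sset_Ob \<iota> T.simplicial_set_segmented)
  interpret K: simplicial_set "obj_map K" "arr_map K" by (rule simplicial_set_SSet[OF K])
  have obj: "obj_map K n = \<iota> ` total_cells n" for n by (simp add: K_def transport_sset_def)
  have arr: "arr_map K n m h (\<iota> q) = \<iota> (T.segmented_act n m h q)" if "q \<in> total_cells n" for n m h q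
    using that by (simp add: K_def transport_sset_def inv_f_f[OF \<iota>])
  have face: "K.face n i j (\<iota> q) = \<iota> (T.cut n i j q)" if "i \<le> j" "j \<le> n" "q \<in> total_cells n" for n i j q
    using that by (simp add: K.face_def arr T.segmented_act_interval_map)
  \<comment> \<open>One known end point determines a 0-cell. The disjunction serves both ends:
    cutting at vertex 0 preserves the first tag, cutting at vertex \<open>n\<close> the
    second.\<close>
  have zero: "q = (a, a, e a)" if "q \<in> total_cells 0" "fst q = a \<or> fst (snd q) = a" for q a
  proof -
    obtain b c u where q: "q = (b, c, u)" "u \<in> obj_map X 0 b c"
      using \<open>q \<in> total_cells 0\<close> by (auto simp: total_cells_def)
    have "b = c" "b \<in> S" using zero_eq[OF q(2)] mem_base[OF q(2)] by auto
    with q e[of b] that(2) show ?thesis by auto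
  qed
  have cut0: "T.cut n 0 0 (a, b, x) = (a, a, e a)" and cutn: "T.cut n n n (a, b, x) = (b, b, e b)"
    if x: "x \<in> obj_map X n a b" for n a b x
  proof -
    obtain c y z where l: "comult X 0 n a b x = (c, y, z)" by (rule prod_cases3)
    obtain d u v where r: "comult X n 0 a b x = (d, u, v)" by (rule prod_cases3)
    have x': "x \<in> obj_map X (0 + n) a b" "x \<in> obj_map X (n + 0) a b" using x by simp_all
    note cl = comult_mem[OF x'(1) l] and cr = comult_mem[OF x'(2) r]
    have t: "(a, b, x) \<in> total_cells n" using x by (simp add: total_cells_def)
    have "(a, c, y) \<in> total_cells 0" "(d, b, v) \<in> total_cells 0"
      using cl cr by (simp_all add: total_cells_def)
    then show "T.cut n 0 0 (a, b, x) = (a, a, e a)" "T.cut n n n (a, b, x) = (b, b, e b)"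
      using zero[of "(a, c, y)" a] zero[of "(d, b, v)" b] T.R_0[of "(a, c, y)" 0] T.L_0[OF t] l r
      by (simp_all add: T.cut_def left_part_def right_part_def)
  qed
  define f where "f = (\<lambda>a\<in>S. \<iota> (a, a, e a))"
  define \<phi> where "\<phi> = (\<lambda>(n::nat) a b x. \<iota> (a, b, x))"
  have f: "f a = \<iota> (a, a, e a)" if "a \<in> S" for a using that by (simp add: f_def)
  \<comment> \<open>The end vertices of a coded triple are the codes of the vertices of its tags. As
    \<iota> is injective, prescribing them as \<open>f a\<close> and \<open>f b\<close> leaves
    exactly the triples tagged \<open>a\<close> and \<open>b\<close>.\<close>
  have mem: "y \<in> obj_map (templicial_of K) n (f a) (f b) \<longleftrightarrow> y \<in> \<phi> n a b ` obj_map X n a b"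
    if "a \<in> S" "b \<in> S" for y n a b
  proof
    assume "y \<in> obj_map (templicial_of K) n (f a) (f b)"
    then have y: "y \<in> \<iota> ` total_cells n" "K.face n 0 0 y = f a" "K.face n n n y = f b"
      by (auto simp: templicial_of_def K.mem_colax_of obj)
    then obtain a' b' x where x: "y = \<iota> (a', b', x)" "x \<in> obj_map X n a' b'" "(a', b', x) \<in> total_cells n"
      by (auto simp: total_cells_def)
    then have "\<iota> (a', a', e a') = f a" "\<iota> (b', b', e b') = f b"
      using y face[OF _ _ x(3), of 0 0] face[OF _ _ x(3), of n n] cut0[OF x(2)] cutn[OF x(2)] by auto
    then have "a' = a" "b' = b" using that by (auto simp: f dest: injD[OF \<iota>])
    with x show "y \<in> \<phi> n a b ` obj_map X n a b" by (simp add: \<phi>_def)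
  next
    assume "y \<in> \<phi> n a b ` obj_map X n a b"
    then obtain x where x: "y = \<iota> (a, b, x)" "x \<in> obj_map X n a b" by (auto simp: \<phi>_def)
    then have t: "(a, b, x) \<in> total_cells n" by (simp add: total_cells_def)
    then have "y \<in> obj_map K n" using x by (simp add: obj)
    then show "y \<in> obj_map (templicial_of K) n (f a) (f b)"
      using face[OF _ _ t, of 0 0] face[OF _ _ t, of n n] cut0[OF x(2)] cutn[OF x(2)] x that
      by (simp add: templicial_of_def K.mem_colax_of f)
  qed
  have bij: "bij_betw (\<phi> n a b) (obj_map X n a b) (obj_map (templicial_of K) n (f a) (f b))"
    if "a \<in> S" "b \<in> S" for n a b
    using mem[OF that] by (auto simp: bij_betw_def \<phi>_def intro!: inj_onI dest: injD[OF \<iota>])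
  \<comment> \<open>The new base set consists of the codes of all vertices, so \<open>f\<close> is a
    bijection onto it.\<close>
  have total0: "total_cells 0 = (\<lambda>a. (a, a, e a)) ` S"
  proof (intro equalityI subsetI)
    fix q assume q: "q \<in> total_cells 0"
    moreover from q have "fst q \<in> S" by (auto simp: total_cells_def dest: mem_base)
    ultimately show "q \<in> (\<lambda>a. (a, a, e a)) ` S" using zero by blast
  next
    fix q assume "q \<in> (\<lambda>a. (a, a, e a)) ` S"
    then show "q \<in> total_cells 0" using e by (auto simp: total_cells_def)
  qed
  have "bij_betw f S (obj_map K 0)"
    unfolding bij_betw_def
  proof
    show "inj_on f S" by (auto simp: inj_on_def f dest: injD[OF \<iota>])
    show "f ` S = obj_map K 0" by (simp add: obj total0 image_image f cong: image_cong_simp)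
  qed
  moreover from this have "f \<in> S \<rightarrow>\<^sub>E obj_map K 0"
    by (auto simp: bij_betw_def f_def PiE_iff)
  moreover have "cell_map X (templicial_of K) f \<phi>"
    unfolding cell_map_def
  proof (intro conjI allI impI)
    fix n a b x assume "x \<in> obj_map X n a b"
    then show "\<phi> n a b x \<in> obj_map (templicial_of K) n (f a) (f b)"
      using mem mem_base by blast
  next
    fix m n h a b x assume h: "h \<in> Hom Delta_f n m" and x: "x \<in> obj_map X m a b"
    then have t: "(a, b, x) \<in> total_cells m" by (simp add: total_cells_def)
    have "\<phi> m a b x \<in> obj_map (templicial_of K) m (f a) (f b)"
      using mem[of a b] mem_base[OF x] x by blast
    then show "\<phi> n a b (arr_map X m n h a b x) = arr_map (templicial_of K) m n h (f a) (f b) (\<phi> m a b x)"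
      using t h by (simp add: templicial_of_def K.arr_map_colax_of)
        (simp add: \<phi>_def arr T.segmented_act_Delta_f total_arr_def)
  next
    fix m n a b c x y z
    assume x: "x \<in> obj_map X (m + n) a b" and c: "comult X m n a b x = (c, y, z)"
    note cm = comult_mem[OF x c]
    have t: "(a, b, x) \<in> total_cells (m + n)" "(a, c, y) \<in> total_cells m" "(c, b, z) \<in> total_cells n"
      using x cm by (simp_all add: total_cells_def)
    have L: "left_part m n (a, b, x) = (a, c, y)" "right_part m n (a, b, x) = (c, b, z)"
      using c by (simp_all add: left_part_def right_part_def)
    \<comment> \<open>The middle vertex of a cut is the last vertex of the left piece, where
      \<open>cutn\<close> identifies it.\<close>
    have "T.cut (m + n) m m (a, b, x) = T.cut m m m (a, c, y)"
      by (simp add: T.cut_def L T.L_0[OF t(2)])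
    then have "T.cut (m + n) m m (a, b, x) = (c, c, e c)"
      using cutn[OF cm(2)] by simp
    moreover have "T.cut (m + n) 0 m (a, b, x) = (a, c, y)"
      by (simp add: T.cut_def L T.R_0[OF t(2)])
    moreover have "T.cut (m + n) m (m + n) (a, b, x) = (c, b, z)"
      by (simp add: T.cut_def L T.L_0[OF t(1)])
    moreover have "\<phi> (m + n) a b x \<in> obj_map (templicial_of K) (m + n) (f a) (f b)"
      using mem[of a b] mem_base[OF x] x by blast
    ultimately show "comult (templicial_of K) m n (f a) (f b) (\<phi> (m + n) a b x) = (f c, \<phi> m a c y, \<phi> n c b z)"
      using t(1) cm(1) by (simp add: templicial_of_def K.comult_colax_of) (simp add: \<phi>_def face f)
  qed
  ultimately have "iso_in TSet (X, S) (templicial_of K, obj_map K 0) (push_cells S X f \<phi>, f)"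
    using bij by (intro iso_in_TSet Ob templicial_Ob K)
  then show ?thesis
    using K by (auto simp: templicial_functor_def)
qed

theorem proposition2p7:
  assumes "infinite (UNIV :: 'u set)"
  shows "equivalent_categories
    (TSet :: ('u templicial, 'u templicial_map) cat)
    (SSet :: ('u sset, nat \<Rightarrow> 'u \<Rightarrow> 'u) cat)"
proof (rule equivalent_categoriesI[OF cat_functor_templicial bij_betw_templicial_functor])
  fix A :: "'u templicial" assume "A \<in> Ob TSet"
  then show "\<exists>K\<in>Ob SSet. \<exists>u. iso_in TSet A (obj_map templicial_functor K) u"
    using essentially_surjective_templicial_functor[OF assms] by (cases A) auto
qed

end
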